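(* Under Assumptions 1-MP, 2-MP (a),(b),(c), 3-MP and Parallel Trends 4-MP(a), and assuming that for each $g\le\mathcal{T}$ and each window $A$ below the map $(a,b)\mapsto\overline{ATT}^A(g,a|g,b)$ is differentiable on $\mathcal{D}_+\times\mathcal{D}_+$, for all $g,k\in\mathcal{G}\setminus\{\mathcal{T}+1\}$ with $k>g$: $$\delta^{WITHIN}(g)=\int_{\mathcal{D}_+}w_1^{within}(g,l)\Big(\overline{ACRT}^{POST(g)}(g,l|g,l)+\frac{\partial\overline{ATT}^{POST(g)}(g,l|g,h)}{\partial h}\Big|_{h=l}\Big)dl,$$ $$\delta^{MID,PRE}(g,k)=\int_{\mathcal{D}_+}w_1(g,l)\Big(\overline{ACRT}^{MID(g,k)}(g,l|g,l)+\frac{\partial\overline{ATT}^{MID(g,k)}(g,l|g,h)}{\partial h}\Big|_{h=l}\Big)dl+w_0(g)\frac{\overline{ATT}^{MID(g,k)}(g,d_L|g,d_L)}{d_L},$$ $$\delta^{POST,MID}(g,k)=\int_{\mathcal{D}_+}w_1(k,l)\Big(\overline{ACRT}^{POST(k)}(k,l|k,l)+\frac{\partial\overline{ATT}^{POST(k)}(k,l|k,h)}{\partial h}\Big|_{h=l}\Big)dl+w_0(k)\frac{\overline{ATT}^{POST(k)}(k,d_L|k,d_L)}{d_L}-w_0(k)\frac{\pi^{POST(k),PRE(g)}(g)-\pi^{MID(g,k),PRE(g)}(g)}{d_L},$$ and, when $\mathbb{E}[D\mid G=g]\ne\mathbb{E}[D\mid G=k]$, $$\delta^{POST,PRE}(g,k)=\int_{\mathcal{D}_+}w_1^{across}(g,k,l)\Big(\overline{ACRT}^{POST(k)}(g,l|g,l)+\frac{\partial\overline{ATT}^{POST(k)}(g,l|g,h)}{\partial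 h}\Big|_{h=l}\Big)dl-\Big\{\int_{\mathcal{D}_+}\tilde w_1^{across}(g,k,l)\Big(\frac{\partial\pi_D^{POST(k),PRE(g)}(k,l)}{\partial l}-\frac{\partial\pi_D^{POST(k),PRE(g)}(g,l)}{\partial l}\Big)dl+\tilde w_0^{across}(g,k)\frac{\pi_D^{POST(k),PRE(g)}(k,d_L)-\pi_D^{POST(k),PRE(g)}(g,d_L)}{d_L}\Big\}.$$
   Context: Multi-period setup. Periods $t=1,\dots,\mathcal{T}$. Each unit has a timing group $G\in\mathcal{G}\subseteq\{2,\dots,\mathcal{T}+1\}$ ($G=\mathcal{T}+1$ means never treated) and a dose $D\ge0$, with $D=0$ exactly for never-treated units and $D\in\mathcal{D}_+$ for units with $G\le\mathcal{T}$. Potential outcomes $Y_t(g,d)$; $Y_t(0):=Y_t(\mathcal{T}+1,0)$. $W_t:=D\mathbf{1}\{t\ge G\}$. Observed $Y_t=Y_t(0)\mathbf{1}\{t<G\}+Y_t(G,D)\mathbf{1}\{t\ge G\}$; finite second moments. 1-MP: i.i.d. sampling of $(Y_1,\dots,Y_{\mathcal{T}},D,G)$. 2-MP: (a) support of $D$ is $\{0\}\cup\mathcal{D}_+$, $\mathbb{P}(D=0)>0$, every $d\in\mathcal{D}_+$ in the support of $D\mid G=g$ for $g\le\mathcal{T}$; (b) $\mathcal{D}_+=[d_L,d_U]$, $0<d_L<d_U<\infty$; (c) $d\mapsto\mathbb{E}[\Delta Y_t\mid G=g,D=d]$ continuously differentiable on $\mathcal{D}_+$. 3-MP: (a) $Y_t(g,d)=Y_t(0)$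 for $t<g$; (b) $W_1=0$, $W_{t-1}=d\Rightarrow W_t=d$. 4-MP(a): for all $g\in\mathcal{G}$, $t=2,\dots,\mathcal{T}$, $d\in\mathcal{D}$: $\mathbb{E}[Y_t(0)-Y_{t-1}(0)\mid G=g,D=d]=\mathbb{E}[Y_t(0)-Y_{t-1}(0)\mid D=0]$. Parameters: for window $A=(t_1,t_2)$, $\overline{ATT}^A(g,a|g,b):=\mathbb{E}\big[\frac1{t_2-t_1+1}\sum_{t=t_1}^{t_2}(Y_t(g,a)-Y_t(0))\mid G=g,D=b\big]$; $\overline{ACRT}^A(g,d|g,d):=\frac{\partial\overline{ATT}^A(g,l|g,d)}{\partial l}\big|_{l=d}$. Notation: $\bar Y^{(t_1,t_2)}:=\frac1{t_2-t_1+1}\sum_{t=t_1}^{t_2}Y_t$; $PRE(g)=(1,g-1)$, $MID(g,k)=(g,k-1)$, $POST(k)=(k,\mathcal{T})$, $\bar Y^A$ average over window $A$. $\pi_D^{A,B}(g,d):=\mathbb{E}[\bar Y^A-\bar Y^B\mid G=g,D=d]-\mathbb{E}[\bar Y^A-\bar Y^B\mid D=0]$; $\pi^{A,B}(g):=\mathbb{E}[\bar Y^A-\bar Y^B\mid G=g]-\mathbb{E}[\bar Y^A-\bar Y^B\mid D=0]$. Comparisons: $\delta^{WITHIN}(g):=\mathrm{cov}(\bar Y^{POST(g)}-\bar Y^{PRE(g)},D\mid G=g)/\mathrm{var}(D\mid G=g)$; $\delta^{MID,PRE}(g,k):=(\mathbb{E}[\bar Y^{MID(g,k)}-\bar Y^{PRE(g)}\mid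 G=g]-\mathbb{E}[\bar Y^{MID(g,k)}-\bar Y^{PRE(g)}\mid G=k])/\mathbb{E}[D\mid G=g]$; $\delta^{POST,MID}(g,k):=(\mathbb{E}[\bar Y^{POST(k)}-\bar Y^{MID(g,k)}\mid G=k]-\mathbb{E}[\bar Y^{POST(k)}-\bar Y^{MID(g,k)}\mid G=g])/\mathbb{E}[D\mid G=k]$; $\delta^{POST,PRE}(g,k):=(\mathbb{E}[\bar Y^{POST(k)}-\bar Y^{PRE(g)}\mid G=g]-\mathbb{E}[\bar Y^{POST(k)}-\bar Y^{PRE(g)}\mid G=k])/(\mathbb{E}[D\mid G=g]-\mathbb{E}[D\mid G=k])$. Weights: $w_1^{within}(g,l):=\frac{(\mathbb{E}[D\mid G=g,D\ge l]-\mathbb{E}[D\mid G=g])\mathbb{P}(D\ge l\mid G=g)}{\mathrm{var}(D\mid G=g)}$; $w_1(g,l):=\frac{\mathbb{P}(D\ge l\mid G=g)}{\mathbb{E}[D\mid G=g]}$; $w_0(g):=\frac{d_L}{\mathbb{E}[D\mid G=g]}$; $w_1^{across}(g,k,l):=\frac{\mathbb{P}(D\ge l\mid G=g)-\mathbb{P}(D\ge l\mid G=k)}{\mathbb{E}[D\mid G=g]-\mathbb{E}[D\mid G=k]}$; $\tilde w_1^{across}(g,k,l):=\frac{\mathbb{P}(D\ge l\mid G=k)}{\mathbb{E}[D\mid G=g]-\mathbb{E}[D\mid G=k]}$; $\tilde w_0^{across}(g,k):=\frac{d_L}{\mathbb{E}[D\mid G=g]-\mathbb{E}[D\mid G=k]}$.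 *)

theory Defs
  imports "HOL-Probability.Probability"
begin

definition evt :: "'a measure \<Rightarrow> ('a \<Rightarrow> bool) \<Rightarrow> 'a set" where
  "evt M P = {\<omega> \<in> space M. P \<omega>}"

definition cexp :: "'a measure \<Rightarrow> ('a \<Rightarrow> real) \<Rightarrow> 'a set \<Rightarrow> real" where
  "cexp M X A = (\<integral>\<omega>. X \<omega> * indicator A \<omega> \<partial>M) / measure M A"

definition cprob :: "'a measure \<Rightarrow> 'a set \<Rightarrow> 'a set \<Rightarrow> real" where
  "cprob M B A = measure M (B \<inter> A) / measure M A"

definition ccov :: "'a measure \<Rightarrow> ('a \<Rightarrow> real) \<Rightarrow> ('a \<Rightarrow> real) \<Rightarrow> 'a set \<Rightarrow> real" where
  "ccov M X Z A = cexp M (\<lambda>\<omega>. (X \<omega> - cexp M X A) * (Z \<omega> - cexp M Z A)) A"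

definition cvar :: "'a measure \<Rightarrow> ('a \<Rightarrow> real) \<Rightarrow> 'a set \<Rightarrow> real" where
  "cvar M Z A = cexp M (\<lambda>\<omega>. (Z \<omega> - cexp M Z A)\<^sup>2) A"

text \<open>f is a version of d \<mapsto> E[X | G = g, D = d]: for every Borel set B,
  E[X 1{G=g, D\<in>B}] = E[f(D) 1{G=g, D\<in>B}].\<close>
definition cversion :: "'a measure \<Rightarrow> ('a \<Rightarrow> real) \<Rightarrow> ('a \<Rightarrow> nat) \<Rightarrow> ('a \<Rightarrow> real) \<Rightarrow> nat
    \<Rightarrow> (real \<Rightarrow> real) \<Rightarrow> bool" where
  "cversion M X G D g f \<longleftrightarrow> f \<in> borel_measurable borel \<and>
     (\<forall>B \<in> sets borel.
        integrable M (\<lambda>\<omega>. f (D \<omega>) * indicator (evt M (\<lambda>\<omega>. G \<omega> = g \<and> D \<omega> \<in> B)) \<omega>) \<and>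
        (\<integral>\<omega>. X \<omega> * indicator (evt M (\<lambda>\<omega>. G \<omega> = g \<and> D \<omega> \<in> B)) \<omega> \<partial>M) =
        (\<integral>\<omega>. f (D \<omega>) * indicator (evt M (\<lambda>\<omega>. G \<omega> = g \<and> D \<omega> \<in> B)) \<omega> \<partial>M))"

definition csupp :: "'a measure \<Rightarrow> ('a \<Rightarrow> real) \<Rightarrow> 'a set \<Rightarrow> real set" where
  "csupp M X A = {x. \<forall>e>0. measure M ({\<omega> \<in> space M. dist (X \<omega>) x < e} \<inter> A) > 0}"

definition C1_on_interval :: "(real \<Rightarrow> real) \<Rightarrow> real \<Rightarrow> real \<Rightarrow> bool" where
  "C1_on_interval f a b \<longleftrightarrow> (\<exists>f'. (\<forall>x\<in>{a..b}. (f has_real_derivative f' x) (at x within {a..b}))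
      \<and> continuous_on {a..b} f')"

definition dw :: "(real \<Rightarrow> real) \<Rightarrow> real set \<Rightarrow> real \<Rightarrow> real" where
  "dw f S x = vector_derivative f (at x within S)"

text \<open>Potential outcomes Yp t g d \<omega> = Y_t(g,d); Y_t(0) = Y_t(T+1,0).\<close>
definition Y0 :: "nat \<Rightarrow> (nat \<Rightarrow> nat \<Rightarrow> real \<Rightarrow> 'a \<Rightarrow> real) \<Rightarrow> nat \<Rightarrow> 'a \<Rightarrow> real" where
  "Y0 T Yp t \<omega> = Yp t (Suc T) 0 \<omega>"

definition obsY :: "nat \<Rightarrow> (nat \<Rightarrow> nat \<Rightarrow> real \<Rightarrow> 'a \<Rightarrow> real) \<Rightarrow> ('a \<Rightarrow> nat) \<Rightarrow> ('a \<Rightarrow> real)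
    \<Rightarrow> nat \<Rightarrow> 'a \<Rightarrow> real" where
  "obsY T Yp G D t \<omega> = (if t < G \<omega> then Y0 T Yp t \<omega> else Yp t (G \<omega>) (D \<omega>) \<omega>)"

definition Wt :: "('a \<Rightarrow> nat) \<Rightarrow> ('a \<Rightarrow> real) \<Rightarrow> nat \<Rightarrow> 'a \<Rightarrow> real" where
  "Wt G D t \<omega> = (if t \<ge> G \<omega> then D \<omega> else 0)"

definition Ybar :: "(nat \<Rightarrow> 'a \<Rightarrow> real) \<Rightarrow> nat \<Rightarrow> nat \<Rightarrow> 'a \<Rightarrow> real" where
  "Ybar Y t1 t2 \<omega> = (\<Sum>t=t1..t2. Y t \<omega>) / real (Suc t2 - t1)"

definition piAB :: "'a measure \<Rightarrow> nat \<Rightarrow> (nat \<Rightarrow> nat \<Rightarrow> real \<Rightarrow> 'a \<Rightarrow> real) \<Rightarrow> ('a \<Rightarrow> nat)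
    \<Rightarrow> ('a \<Rightarrow> real) \<Rightarrow> nat \<Rightarrow> nat \<Rightarrow> nat \<Rightarrow> nat \<Rightarrow> nat \<Rightarrow> real" where
  "piAB M T Yp G D a1 a2 b1 b2 g =
     (let Y = obsY T Yp G D; X = (\<lambda>\<omega>. Ybar Y a1 a2 \<omega> - Ybar Y b1 b2 \<omega>)
      in cexp M X (evt M (\<lambda>\<omega>. G \<omega> = g)) - cexp M X (evt M (\<lambda>\<omega>. D \<omega> = 0)))"

text \<open>pi_D^{A,B}(g,d), with E[Ybar^A - Ybar^B | G=g, D=d] computed from the fixed versions
  mDY t g d of E[Y_t - Y_{t-1} | G=g, D=d] via Y_t = Y_1 + sum_{r=2..t} (Y_r - Y_{r-1}).\<close>
definition piD :: "'a measure \<Rightarrow> nat \<Rightarrow> (nat \<Rightarrow> nat \<Rightarrow> real \<Rightarrow> 'a \<Rightarrow> real) \<Rightarrow> ('a \<Rightarrow> nat)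
    \<Rightarrow> ('a \<Rightarrow> real) \<Rightarrow> (nat \<Rightarrow> nat \<Rightarrow> real \<Rightarrow> real) \<Rightarrow> nat \<Rightarrow> nat \<Rightarrow> nat \<Rightarrow> nat \<Rightarrow> nat \<Rightarrow> real \<Rightarrow> real" where
  "piD M T Yp G D mDY a1 a2 b1 b2 g d =
     (let Y = obsY T Yp G D; X = (\<lambda>\<omega>. Ybar Y a1 a2 \<omega> - Ybar Y b1 b2 \<omega>)
      in ((\<Sum>t=a1..a2. \<Sum>r=2..t. mDY r g d) / real (Suc a2 - a1)
          - (\<Sum>t=b1..b2. \<Sum>r=2..t. mDY r g d) / real (Suc b2 - b1))
         - cexp M X (evt M (\<lambda>\<omega>. D \<omega> = 0)))"

definition deltaWITHIN where
  "deltaWITHIN M T Yp G D g =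
     (let Y = obsY T Yp G D; A = evt M (\<lambda>\<omega>. G \<omega> = g)
      in ccov M (\<lambda>\<omega>. Ybar Y g T \<omega> - Ybar Y 1 (g - 1) \<omega>) D A / cvar M D A)"

definition deltaMIDPRE where
  "deltaMIDPRE M T Yp G D g k =
     (let Y = obsY T Yp G D; X = (\<lambda>\<omega>. Ybar Y g (k - 1) \<omega> - Ybar Y 1 (g - 1) \<omega>)
      in (cexp M X (evt M (\<lambda>\<omega>. G \<omega> = g)) - cexp M X (evt M (\<lambda>\<omega>. G \<omega> = k)))
         / cexp M D (evt M (\<lambda>\<omega>. G \<omega> = g)))"

definition deltaPOSTMID where
  "deltaPOSTMID M T Yp G D g k =
     (let Y = obsY T Yp G D; X = (\<lambda>\<omega>. Ybar Y k T \<omega> - Ybar Y g (k - 1) \<omega>)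
      in (cexp M X (evt M (\<lambda>\<omega>. G \<omega> = k)) - cexp M X (evt M (\<lambda>\<omega>. G \<omega> = g)))
         / cexp M D (evt M (\<lambda>\<omega>. G \<omega> = k)))"

definition deltaPOSTPRE where
  "deltaPOSTPRE M T Yp G D g k =
     (let Y = obsY T Yp G D; X = (\<lambda>\<omega>. Ybar Y k T \<omega> - Ybar Y 1 (g - 1) \<omega>)
      in (cexp M X (evt M (\<lambda>\<omega>. G \<omega> = g)) - cexp M X (evt M (\<lambda>\<omega>. G \<omega> = k)))
         / (cexp M D (evt M (\<lambda>\<omega>. G \<omega> = g)) - cexp M D (evt M (\<lambda>\<omega>. G \<omega> = k))))"

definition w1within where
  "w1within M G D g l =
     (let A = evt M (\<lambda>\<omega>. G \<omega> = g); B = evt M (\<lambda>\<omega>. G \<omega> = g \<and> D \<omega> \<ge> l)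
      in (cexp M D B - cexp M D A) * cprob M (evt M (\<lambda>\<omega>. D \<omega> \<ge> l)) A / cvar M D A)"

definition w1 where
  "w1 M G D g l = cprob M (evt M (\<lambda>\<omega>. D \<omega> \<ge> l)) (evt M (\<lambda>\<omega>. G \<omega> = g))
                  / cexp M D (evt M (\<lambda>\<omega>. G \<omega> = g))"

definition w0 where
  "w0 M G D dL g = dL / cexp M D (evt M (\<lambda>\<omega>. G \<omega> = g))"

definition w1across where
  "w1across M G D g k l =
     (cprob M (evt M (\<lambda>\<omega>. D \<omega> \<ge> l)) (evt M (\<lambda>\<omega>. G \<omega> = g))
      - cprob M (evt M (\<lambda>\<omega>. D \<omega> \<ge> l)) (evt M (\<lambda>\<omega>. G \<omega> = k)))
     / (cexp M D (evt M (\<lambda>\<omega>. G \<omega> = g)) - cexp M D (evt M (\<lambda>\<omega>. G \<omega> = k)))"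

definition w1across_t where
  "w1across_t M G D g k l =
     cprob M (evt M (\<lambda>\<omega>. D \<omega> \<ge> l)) (evt M (\<lambda>\<omega>. G \<omega> = k))
     / (cexp M D (evt M (\<lambda>\<omega>. G \<omega> = g)) - cexp M D (evt M (\<lambda>\<omega>. G \<omega> = k)))"

definition w0across_t where
  "w0across_t M G D dL g k =
     dL / (cexp M D (evt M (\<lambda>\<omega>. G \<omega> = g)) - cexp M D (evt M (\<lambda>\<omega>. G \<omega> = k)))"

text \<open>ATT t1 t2 g a b is, for each fixed dose a in D+, a version of
  b \<mapsto> E[ (1/(t2-t1+1)) sum_{t=t1..t2} (Y_t(g,a) - Y_t(0)) | G = g, D = b ],
  and the diagonal b \<mapsto> ATT t1 t2 g b b is a version of E[ ... Y_t(g,D) ... | G = g, D = b ]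
  (i.e. E[Y_t(g,d) - Y_t(0) | G=g, D=d] is evaluated at the realised dose d = D).\<close>
definition ATT_version where
  "ATT_version M T Yp G D dL dU ATT g t1 t2 \<longleftrightarrow>
     (\<forall>a\<in>{dL..dU}. cversion M (Ybar (\<lambda>t \<omega>. Yp t g a \<omega> - Y0 T Yp t \<omega>) t1 t2) G D g (ATT t1 t2 g a))
     \<and> cversion M (Ybar (\<lambda>t \<omega>. Yp t g (D \<omega>) \<omega> - Y0 T Yp t \<omega>) t1 t2) G D g (\<lambda>b. ATT t1 t2 g b b)"

definition ATT_diff where
  "ATT_diff dL dU ATT g t1 t2 \<longleftrightarrow>
     (\<lambda>p. ATT t1 t2 g (fst p) (snd p)) differentiable_on ({dL..dU} \<times> {dL..dU})"

definition ACRT_plus where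
  "ACRT_plus dL dU ATT g t1 t2 l =
     dw (\<lambda>x. ATT t1 t2 g x l) {dL..dU} l + dw (\<lambda>h. ATT t1 t2 g l h) {dL..dU} l"

end

theory Submission
  imports Defs
begin

text \<open>
  On the group $G = h$, parallel trends identifies $\pi_D(h, d)$ and the diagonal
  $\overline{ATT}(h, d | h, d)$ as versions of the same conditional mean given the dose. Both are
  continuous and the conditional support of the dose is $[d_L, d_U]$, so they agree everywhere on
  that interval; hence the diagonal is $C^1$, and by the chain rule its derivative is the sum of the
  two partial derivatives in the statement.
  All four formulas then come from the layer-cake identity
  $E[Z f(D)] = f(d_L) E[Z] + \int f'(l) E[Z 1\{D \ge l\}] dl$
  with $Z = 1\{G = h\}$ or $Z = (D - E[D | G = h]) 1\{G = h\}$.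
\<close>

text \<open>A conditional mean given the dose is fixed by \<open>cversion\<close> only up to null
  sets, while the formulas read its value at \<open>dL\<close> and its slope at every dose;
  continuity together with full conditional support closes this gap. The differentiability assumed
  of \<open>ATT\<close> is pointwise and says nothing about integrability of
  \<open>ACRT_plus\<close>; that is inherited from the C1 versions \<open>mDY\<close> of the
  observed increments. The choice of Z decides the boundary term: an indicator leaves the value at
  \<open>dL\<close>, the source of the \<open>w0\<close> terms, while the centred dose has mean zero
  and leaves none. The last three comparisons differ in what the other group contributes. Before k,
  group k is untreated and drops out of MID - PRE. Group g is already treated during MID and
  POST(k), so its change over these windows survives in POST - MID as the bias. In POST - PRE both
  groups are treated, and the slope of group g weighted by the dose tails of group k is added and
  subtracted.\<close>

section \<open>The layer-cake identity\<close>

text \<open>Fubini for the product of Z, 1{l <= D} and f'(l): integrating out l first gives Z times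
  f(D) - f(a) by the fundamental theorem of calculus. With \<open>has_integral\<close>,
  integrability over the interval comes along and integrals can later be added. The dose of the
  never treated is 0, outside the interval; hence D is located only where Z does not vanish.\<close>

lemma integral_mult_C1_comp:
  fixes Z D :: "'a \<Rightarrow> real" and f f' :: "real \<Rightarrow> real"
  assumes fin: "finite_measure M" and Z: "integrable M Z" and D: "D \<in> borel_measurable M"
    and supp: "\<And>\<omega>. \<omega> \<in> space M \<Longrightarrow> Z \<omega> \<noteq> 0 \<Longrightarrow> D \<omega> \<in> {a..b}"
    and deriv: "\<And>x. x \<in> {a..b} \<Longrightarrow> (f has_real_derivative f' x) (at x within {a..b})"
    and cont: "continuous_on {a..b} f'"
  shows "((\<lambda>l. (\<integral>\<omega>. Z \<omega> * indicator {l..} (D \<omega>) \<partial>M) * f' l) has_integral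
           (\<integral>\<omega>. Z \<omega> * f (D \<omega>) \<partial>M) - f a * (\<integral>\<omega>. Z \<omega> \<partial>M)) {a..b}"
proof -
  interpret finite_measure M by (rule fin)
  interpret P: pair_sigma_finite M lborel ..
  \<comment> \<open>Extending f' by 0 moves the integral to all of \<open>lborel\<close> and yields
    a Borel function, although f' is controlled only on the interval.\<close>
  define u where "u l = indicator {a..b} l * f' l" for l
  have u_meas [measurable]: "u \<in> borel_measurable borel"
    using borel_measurable_continuous_on_indicator[OF _ cont] by (simp add: u_def[abs_def])
  have [measurable]: "Z \<in> borel_measurable M" "D \<in> borel_measurable M"
    using Z D by auto
  have u_int: "integrable lborel u"
    using borel_integrable_compact[OF compact_Icc cont]
    by (simp add: u_def[abs_def])
  have inner: "integrable lborel (\<lambda>l. Z \<omega> * indicator {l..} (D \<omega>) * u l)" for \<omega>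
  proof (rule Bochner_Integration.integrable_bound)
    show "integrable lborel (\<lambda>l. Z \<omega> * u l)" using u_int by simp
  qed (auto simp: indicator_def)
  have prod_meas: "(\<lambda>(\<omega>, l). Z \<omega> * indicator {l..} (D \<omega>) * u l) \<in> borel_measurable (M \<Otimes>\<^sub>M lborel)"
    by (simp add: indicator_def of_bool_def)
  \<comment> \<open>Z may change sign, so absolute integrability on the product comes first; the
    bound is |Z| times the integral of |u|.\<close>
  have prod_int: "integrable (M \<Otimes>\<^sub>M lborel) (\<lambda>(\<omega>, l). Z \<omega> * indicator {l..} (D \<omega>) * u l)"
  proof (rule P.Fubini_integrable)
    show "integrable M (\<lambda>\<omega>. \<integral>l. norm (case (\<omega>, l) of (\<omega>, l) \<Rightarrow>
        Z \<omega> * indicator {l..} (D \<omega>) * u l) \<partial>lborel)"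
    proof (rule Bochner_Integration.integrable_bound)
      show "integrable M (\<lambda>\<omega>. \<bar>Z \<omega>\<bar> * (\<integral>l. \<bar>u l\<bar> \<partial>lborel))" using Z by simp
      show "(\<lambda>\<omega>. \<integral>l. norm (case (\<omega>, l) of (\<omega>, l) \<Rightarrow>
        Z \<omega> * indicator {l..} (D \<omega>) * u l) \<partial>lborel) \<in> borel_measurable M"
        by (simp add: indicator_def of_bool_def)
      have "(\<integral>l. \<bar>Z \<omega> * indicator {l..} (D \<omega>) * u l\<bar> \<partial>lborel) \<le> (\<integral>l. \<bar>Z \<omega>\<bar> * \<bar>u l\<bar> \<partial>lborel)" for \<omega>
      proof (rule integral_mono)
        show "integrable lborel (\<lambda>l. \<bar>Z \<omega> * indicator {l..} (D \<omega>) * u l\<bar>)" using inner by simp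
        show "integrable lborel (\<lambda>l. \<bar>Z \<omega>\<bar> * \<bar>u l\<bar>)" using u_int by simp
      qed (auto simp: indicator_def abs_mult)
      then show "AE \<omega> in M. norm (\<integral>l. norm (case (\<omega>, l) of (\<omega>, l) \<Rightarrow>
          Z \<omega> * indicator {l..} (D \<omega>) * u l) \<partial>lborel) \<le> norm (\<bar>Z \<omega>\<bar> * (\<integral>l. \<bar>u l\<bar> \<partial>lborel))"
        by (simp add: abs_mult)
    qed
  qed (use prod_meas inner in auto)
  have FTC: "(\<integral>l. indicator {l..} x * u l \<partial>lborel) = f x - f a" if x: "x \<in> {a..b}" for x
  proof -
    have "(f' has_integral (f x - f a)) {a..x}"
    proof (rule fundamental_theorem_of_calculus)
      show "(f has_vector_derivative f' y) (at y within {a..x})" if "y \<in> {a..x}" for y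
        using deriv[of y] that x
        by (auto simp: has_real_derivative_iff_has_vector_derivative
            intro: has_vector_derivative_within_subset)
    qed (use x in auto)
    moreover have "integrable lborel (\<lambda>l. indicator {a..x} l *\<^sub>R f' l)"
      using borel_integrable_compact[OF compact_Icc continuous_on_subset[OF cont, of "{a..x}"]] x
      by simp
    ultimately have "(\<integral>l. indicator {a..x} l *\<^sub>R f' l \<partial>lborel) = f x - f a"
      using set_borel_integral_eq_integral(2)[of "{a..x}" f']
      by (auto simp: set_integrable_def set_lebesgue_integral_def integral_unique)
    also have "(\<lambda>l. indicator {a..x} l *\<^sub>R f' l) = (\<lambda>l. indicator {l..} x * u l)"
      using x by (auto simp: u_def indicator_def fun_eq_iff)
    finally show ?thesis .
  qed
  have Zu: "(\<integral>l. Z \<omega> * indicator {l..} (D \<omega>) * u l \<partial>lborel) = Z \<omega> * f (D \<omega>) - f a * Z \<omega>"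
    if "\<omega> \<in> space M" for \<omega>
    using FTC[OF supp[OF that]] by (cases "Z \<omega> = 0") (simp_all add: mult.assoc right_diff_distrib)
  have Zu_int: "integrable M (\<lambda>\<omega>. \<integral>l. Z \<omega> * indicator {l..} (D \<omega>) * u l \<partial>lborel)"
    using P.integrable_fst'[OF prod_int] by simp
  \<comment> \<open>Nothing is known about f outside \<open>{a..b}\<close>, so measurability and
    integrability of Z f(D) are read off from the iterated integral.\<close>
  have "integrable M (\<lambda>\<omega>. Z \<omega> * f (D \<omega>) - f a * Z \<omega>)"
    using Zu_int by (subst (asm) Bochner_Integration.integrable_cong[OF refl Zu]) auto
  from Bochner_Integration.integrable_add[OF this integrable_mult_right[OF Z, of "f a"]]
  have Zf: "integrable M (\<lambda>\<omega>. Z \<omega> * f (D \<omega>))" by simp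
  have eq: "(\<integral>l. (\<integral>\<omega>. Z \<omega> * indicator {l..} (D \<omega>) * u l \<partial>M) \<partial>lborel)
      = (\<integral>\<omega>. Z \<omega> * f (D \<omega>) \<partial>M) - f a * (\<integral>\<omega>. Z \<omega> \<partial>M)"
  proof -
    have "(\<integral>l. (\<integral>\<omega>. Z \<omega> * indicator {l..} (D \<omega>) * u l \<partial>M) \<partial>lborel)
       = (\<integral>\<omega>. (\<integral>l. Z \<omega> * indicator {l..} (D \<omega>) * u l \<partial>lborel) \<partial>M)"
      using P.Fubini_integral[OF prod_int] by simp
    also have "\<dots> = (\<integral>\<omega>. Z \<omega> * f (D \<omega>) - f a * Z \<omega> \<partial>M)"
      by (rule Bochner_Integration.integral_cong) (auto simp: Zu)
    also have "\<dots> = (\<integral>\<omega>. Z \<omega> * f (D \<omega>) \<partial>M) - f a * (\<integral>\<omega>. Z \<omega> \<partial>M)"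
      using Zf Z by simp
    finally show ?thesis .
  qed
  have "integrable lborel (\<lambda>l. \<integral>\<omega>. Z \<omega> * indicator {l..} (D \<omega>) * u l \<partial>M)"
    using P.integrable_snd[OF prod_int] by simp
  from has_integral_integral_lborel[OF this, unfolded eq]
  have "((\<lambda>l. (\<integral>\<omega>. Z \<omega> * indicator {l..} (D \<omega>) \<partial>M) * u l) has_integral
           (\<integral>\<omega>. Z \<omega> * f (D \<omega>) \<partial>M) - f a * (\<integral>\<omega>. Z \<omega> \<partial>M)) UNIV"
    by simp
  also have "(\<lambda>l. (\<integral>\<omega>. Z \<omega> * indicator {l..} (D \<omega>) \<partial>M) * u l) =
      (\<lambda>l. if l \<in> {a..b} then (\<integral>\<omega>. Z \<omega> * indicator {l..} (D \<omega>) \<partial>M) * f' l else 0)"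
    by (auto simp: u_def)
  finally show ?thesis
    by (simp only: has_integral_restrict_UNIV)
qed

section \<open>Versions of conditional means given the dose\<close>

lemma evt_Int_space [simp]: "evt M P \<inter> space M = evt M P"
  by (auto simp: evt_def)

lemma integrable_mult_indicator_evt:
  fixes X :: "'a \<Rightarrow> real"
  assumes "integrable M X" "{\<omega> \<in> space M. P \<omega>} \<in> sets M"
  shows "integrable M (\<lambda>\<omega>. X \<omega> * indicator (evt M P) \<omega>)"
  using integrable_mult_indicator[OF assms(2,1)] by (simp add: evt_def mult.commute)

lemma cversion_const_0: "cversion M (\<lambda>_. 0) G D h (\<lambda>_. 0)"
  by (simp add: cversion_def)

lemma cversionD:
  assumes "cversion M X G D h f" "B \<in> sets borel"
  shows "integrable M (\<lambda>\<omega>. f (D \<omega>) * indicator (evt M (\<lambda>\<omega>. G \<omega> = h \<and> D \<omega> \<in> B)) \<omega>)"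
    and "(\<integral>\<omega>. X \<omega> * indicator (evt M (\<lambda>\<omega>. G \<omega> = h \<and> D \<omega> \<in> B)) \<omega> \<partial>M) =
         (\<integral>\<omega>. f (D \<omega>) * indicator (evt M (\<lambda>\<omega>. G \<omega> = h \<and> D \<omega> \<in> B)) \<omega> \<partial>M)"
  using assms unfolding cversion_def by blast+

text \<open>Every event in \<open>cversion\<close> lies in {G = h}, so the values of X elsewhere are
  invisible to it.\<close>

lemma cversion_cong:
  assumes "cversion M X G D h f" and "\<And>\<omega>. \<omega> \<in> space M \<Longrightarrow> G \<omega> = h \<Longrightarrow> X \<omega> = X' \<omega>"
  shows "cversion M X' G D h f"
proof -
  have "(\<integral>\<omega>. X' \<omega> * indicator (evt M (\<lambda>\<omega>. G \<omega> = h \<and> D \<omega> \<in> B)) \<omega> \<partial>M) =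
        (\<integral>\<omega>. X \<omega> * indicator (evt M (\<lambda>\<omega>. G \<omega> = h \<and> D \<omega> \<in> B)) \<omega> \<partial>M)" for B
    by (rule Bochner_Integration.integral_cong) (auto simp: evt_def indicator_def assms(2))
  then show ?thesis using assms(1) by (simp add: cversion_def)
qed

locale group_dose = prob_space M for M :: "'a measure" +
  fixes G :: "'a \<Rightarrow> nat" and D :: "'a \<Rightarrow> real"
  assumes G_meas [measurable]: "G \<in> measurable M (count_space UNIV)"
    and D_meas [measurable]: "D \<in> borel_measurable M"
begin

lemma sets_evt:
  assumes [measurable]: "B \<in> sets borel"
  shows "evt M (\<lambda>\<omega>. G \<omega> = h \<and> D \<omega> \<in> B) \<in> sets M"
  unfolding evt_def by measurable

lemma sets_evt_G [measurable]: "evt M (\<lambda>\<omega>. G \<omega> = h) \<in> sets M"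
  unfolding evt_def by measurable

lemma integrable_mult_indicator_G:
  "integrable M X \<Longrightarrow> integrable M (\<lambda>\<omega>. X \<omega> * indicator (evt M (\<lambda>\<omega>. G \<omega> = h)) \<omega> :: real)"
  by (rule integrable_mult_indicator_evt) (auto simp flip: evt_def)

lemma cversion_scale:
  assumes "cversion M X G D h f"
  shows "cversion M (\<lambda>\<omega>. X \<omega> / c) G D h (\<lambda>d. f d / c)"
  using assms by (auto simp: cversion_def)

text \<open>\<open>cversion\<close> guarantees integrability of f(D) only. For X it is a separate
  premise, since the Bochner integral of a non-integrable function is 0 by default and hence not
  additive.\<close>

lemma cversion_add:
  assumes "cversion M X G D h f" "cversion M X' G D h f'" "integrable M X" "integrable M X'"
  shows "cversion M (\<lambda>\<omega>. X \<omega> + X' \<omega>) G D h (\<lambda>d. f d + f' d)"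
  unfolding cversion_def
proof (intro conjI ballI)
  fix B :: "real set" assume B: "B \<in> sets borel"
  let ?I = "\<lambda>\<omega>. indicator (evt M (\<lambda>\<omega>. G \<omega> = h \<and> D \<omega> \<in> B)) \<omega> :: real"
  have *: "integrable M (\<lambda>\<omega>. X \<omega> * ?I \<omega>)" "integrable M (\<lambda>\<omega>. X' \<omega> * ?I \<omega>)"
    "integrable M (\<lambda>\<omega>. f (D \<omega>) * ?I \<omega>)" "integrable M (\<lambda>\<omega>. f' (D \<omega>) * ?I \<omega>)"
    "(\<integral>\<omega>. X \<omega> * ?I \<omega> \<partial>M) = (\<integral>\<omega>. f (D \<omega>) * ?I \<omega> \<partial>M)"
    "(\<integral>\<omega>. X' \<omega> * ?I \<omega> \<partial>M) = (\<integral>\<omega>. f' (D \<omega>) * ?I \<omega> \<partial>M)"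
    using integrable_mult_indicator_evt[OF assms(3) sets_evt[OF B, of h, unfolded evt_def]]
      integrable_mult_indicator_evt[OF assms(4) sets_evt[OF B, of h, unfolded evt_def]]
      cversionD[OF assms(1) B] cversionD[OF assms(2) B] by simp_all
  show "integrable M (\<lambda>\<omega>. (f (D \<omega>) + f' (D \<omega>)) * ?I \<omega>)"
    using * by (simp add: distrib_right)
  show "(\<integral>\<omega>. (X \<omega> + X' \<omega>) * ?I \<omega> \<partial>M) = (\<integral>\<omega>. (f (D \<omega>) + f' (D \<omega>)) * ?I \<omega> \<partial>M)"
    using * by (simp add: distrib_right)
qed (use assms in \<open>auto simp: cversion_def\<close>)

lemma cversion_diff:
  assumes "cversion M X G D h f" "cversion M X' G D h f'" "integrable M X" "integrable M X'"
  shows "cversion M (\<lambda>\<omega>. X \<omega> - X' \<omega>) G D h (\<lambda>d. f d - f' d)"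
  using cversion_add[OF assms(1) cversion_scale[OF assms(2), of "-1"]] assms(3,4) by simp

lemma cversion_sum:
  assumes "finite I" "\<And>i. i \<in> I \<Longrightarrow> cversion M (X i) G D h (f i)" "\<And>i. i \<in> I \<Longrightarrow> integrable M (X i)"
  shows "cversion M (\<lambda>\<omega>. \<Sum>i\<in>I. X i \<omega>) G D h (\<lambda>d. \<Sum>i\<in>I. f i d)"
  using assms
proof (induction I rule: finite_induct)
  case empty
  then show ?case by (simp add: cversion_const_0)
next
  case (insert i I)
  then show ?case
    by (auto intro!: cversion_add)
qed

lemma cversion_integral_eq:
  assumes "cversion M X G D h f"
  shows "integrable M (\<lambda>\<omega>. f (D \<omega>) * indicator (evt M (\<lambda>\<omega>. G \<omega> = h)) \<omega>)"
    and "(\<integral>\<omega>. X \<omega> * indicator (evt M (\<lambda>\<omega>. G \<omega> = h)) \<omega> \<partial>M) =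
         (\<integral>\<omega>. f (D \<omega>) * indicator (evt M (\<lambda>\<omega>. G \<omega> = h)) \<omega> \<partial>M)"
  using cversionD[OF assms, of UNIV] by simp_all

text \<open>If f exceeded f' at x, continuity would keep f - f' positive near x. Doses near x have
  positive probability in group h because x is in the conditional support, so the integrals of f(D)
  and f'(D) over that event could not agree. Exchanging f and f' then gives equality.\<close>

lemma cversion_le_on_csupp:
  assumes v: "cversion M X G D h f" "cversion M X G D h f'"
    and cont: "continuous_on {a..b} f" "continuous_on {a..b} f'"
    and D_in: "\<And>\<omega>. \<omega> \<in> space M \<Longrightarrow> G \<omega> = h \<Longrightarrow> D \<omega> \<in> {a..b}"
    and x: "x \<in> {a..b}" "x \<in> csupp M D (evt M (\<lambda>\<omega>. G \<omega> = h))"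
  shows "f x \<le> f' x"
proof (rule ccontr)
  assume "\<not> f x \<le> f' x"
  then have pos: "0 < f x - f' x" by simp
  have "continuous_on {a..b} (\<lambda>y. f y - f' y)"
    using cont by (intro continuous_intros)
  \<comment> \<open>The tolerance is the gap f(x) - f'(x) itself, so within distance e the
    difference cannot reach 0.\<close>
  from this[unfolded continuous_on_iff, rule_format, OF x(1) pos]
  obtain e where e: "e > 0"
    "\<And>y. y \<in> {a..b} \<Longrightarrow> dist y x < e \<Longrightarrow> dist (f y - f' y) (f x - f' x) < f x - f' x" by auto
  have gt: "0 < f y - f' y" if "y \<in> {a..b}" "dist y x < e" for y
    using e(2)[OF that] by (auto simp: dist_real_def)
  define E where "E = evt M (\<lambda>\<omega>. G \<omega> = h \<and> D \<omega> \<in> ball x e)"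
  have E_eq: "E = {\<omega> \<in> space M. dist (D \<omega>) x < e} \<inter> evt M (\<lambda>\<omega>. G \<omega> = h)"
    by (auto simp: E_def evt_def dist_commute)
  have E_sets: "E \<in> sets M" unfolding E_def by (rule sets_evt) simp
  have E_pos: "measure M E > 0"
    using x(2) e(1) by (auto simp: csupp_def E_eq)
  define u where "u \<omega> = (f (D \<omega>) - f' (D \<omega>)) * indicator E \<omega>" for \<omega>
  have ball: "ball x e \<in> sets borel" by simp
  have i: "integrable M (\<lambda>\<omega>. f (D \<omega>) * indicator E \<omega>)" "integrable M (\<lambda>\<omega>. f' (D \<omega>) * indicator E \<omega>)"
    "(\<integral>\<omega>. f (D \<omega>) * indicator E \<omega> \<partial>M) = (\<integral>\<omega>. f' (D \<omega>) * indicator E \<omega> \<partial>M)"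
    unfolding E_def using cversionD[OF v(1) ball] cversionD[OF v(2) ball] by simp_all
  have u_int: "integrable M u" "(\<integral>\<omega>. u \<omega> \<partial>M) = 0"
    using i by (simp_all add: u_def[abs_def] left_diff_distrib)
  have u_pos: "u \<omega> > 0" if "\<omega> \<in> E" for \<omega>
    using that gt[of "D \<omega>"] D_in[of \<omega>] by (auto simp: u_def E_eq evt_def)
  have "AE \<omega> in M. 0 \<le> u \<omega>"
    using u_pos by (intro AE_I2) (metis indicator_simps(2) less_eq_real_def mult_zero_right u_def)
  with integral_nonneg_eq_0_iff_AE[OF u_int(1)] u_int(2) have "AE \<omega> in M. u \<omega> = 0" by simp
  then have "AE \<omega> in M. \<omega> \<notin> E" by eventually_elim (use u_pos in force)
  then have "measure M E = 0"
    using prob_eq_0[OF E_sets] by simp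
  with E_pos show False by simp
qed

lemma cversion_unique_on_csupp:
  assumes "cversion M X G D h f" "cversion M X G D h f'"
    and "continuous_on {a..b} f" "continuous_on {a..b} f'"
    and "\<And>\<omega>. \<omega> \<in> space M \<Longrightarrow> G \<omega> = h \<Longrightarrow> D \<omega> \<in> {a..b}"
    and "x \<in> {a..b}" "x \<in> csupp M D (evt M (\<lambda>\<omega>. G \<omega> = h))"
  shows "f x = f' x"
  using cversion_le_on_csupp[OF assms] cversion_le_on_csupp[OF assms(2,1,4,3,5-)] by force

text \<open>The defining identities of a version give $E[(X - f(D)) 1\{G = h, D \ge l\}] = 0$ for all $l$;
  integrating over $l$ produces the factor $D$.\<close>
lemma cversion_integral_mult_dose:
  assumes v: "cversion M X G D h f" and X: "integrable M X"
    and D_in: "\<And>\<omega>. \<omega> \<in> space M \<Longrightarrow> G \<omega> = h \<Longrightarrow> D \<omega> \<in> {a..b}"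
  shows "(\<integral>\<omega>. (X \<omega> - f (D \<omega>)) * indicator (evt M (\<lambda>\<omega>. G \<omega> = h)) \<omega> * D \<omega> \<partial>M) = 0"
proof -
  let ?Z = "\<lambda>\<omega>. (X \<omega> - f (D \<omega>)) * indicator (evt M (\<lambda>\<omega>. G \<omega> = h)) \<omega>"
  note i = integrable_mult_indicator_G[OF X, of h] cversion_integral_eq[OF v]
  have Z: "integrable M ?Z" "(\<integral>\<omega>. ?Z \<omega> \<partial>M) = 0"
    using i by (simp_all add: left_diff_distrib)
  have tail: "(\<integral>\<omega>. ?Z \<omega> * indicator {l..} (D \<omega>) \<partial>M) = 0" for l
  proof -
    let ?I = "\<lambda>\<omega>. indicator (evt M (\<lambda>\<omega>. G \<omega> = h \<and> D \<omega> \<in> {l..})) \<omega> :: real"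
    have l: "{l..} \<in> sets borel" by simp
    have *: "integrable M (\<lambda>\<omega>. X \<omega> * ?I \<omega>)" "integrable M (\<lambda>\<omega>. f (D \<omega>) * ?I \<omega>)"
      "(\<integral>\<omega>. X \<omega> * ?I \<omega> \<partial>M) = (\<integral>\<omega>. f (D \<omega>) * ?I \<omega> \<partial>M)"
      using integrable_mult_indicator_evt[OF X sets_evt[OF l, of h, unfolded evt_def]] cversionD[OF v l]
      by simp_all
    have "(\<integral>\<omega>. ?Z \<omega> * indicator {l..} (D \<omega>) \<partial>M) = (\<integral>\<omega>. X \<omega> * ?I \<omega> - f (D \<omega>) * ?I \<omega> \<partial>M)"
      by (rule Bochner_Integration.integral_cong) (auto simp: evt_def indicator_def)
    also have "\<dots> = 0" using * by simp
    finally show ?thesis .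
  qed
  have "((\<lambda>l. (\<integral>\<omega>. ?Z \<omega> * indicator {l..} (D \<omega>) \<partial>M) * 1) has_integral
      (\<integral>\<omega>. ?Z \<omega> * D \<omega> \<partial>M) - a * (\<integral>\<omega>. ?Z \<omega> \<partial>M)) {a..b}"
    by (rule integral_mult_C1_comp[where f = "\<lambda>x. x" and f' = "\<lambda>_. 1"])
      (use Z D_in in \<open>auto simp: evt_def indicator_def finite_measure_axioms split: if_splits\<close>)
  then show ?thesis
    using Z(2) by (simp add: tail has_integral_0_eq)
qed

end

section \<open>Window averages in terms of first differences\<close>

text \<open>A difference of two window averages as a linear functional of the increments Y_r -
  Y_(r-1); the level Y_1 cancels. The same functional is applied to outcomes, to \<open>mDY\<close>,
  to its derivatives and to conditional means, so each property passes from increments to windows by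
  linearity.\<close>

definition window_diff :: "nat \<Rightarrow> nat \<Rightarrow> nat \<Rightarrow> nat \<Rightarrow> (nat \<Rightarrow> real) \<Rightarrow> real" where
  "window_diff a1 a2 b1 b2 F = (\<Sum>t=a1..a2. \<Sum>r=2..t. F r) / real (Suc a2 - a1)
     - (\<Sum>t=b1..b2. \<Sum>r=2..t. F r) / real (Suc b2 - b1)"

lemma Ybar_telescope:
  assumes "1 \<le> a1" "a1 \<le> a2"
  shows "Ybar Y a1 a2 \<omega> = Y 1 \<omega> + (\<Sum>t=a1..a2. \<Sum>r=2..t. Y r \<omega> - Y (r - 1) \<omega>) / real (Suc a2 - a1)"
proof -
  have tele: "Y t \<omega> = Y 1 \<omega> + (\<Sum>r=2..t. Y r \<omega> - Y (r - 1) \<omega>)" if "1 \<le> t" for t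
    using that by (induction t rule: dec_induct) auto
  have "(\<Sum>t=a1..a2. Y t \<omega>) = (\<Sum>t=a1..a2. Y 1 \<omega> + (\<Sum>r=2..t. Y r \<omega> - Y (r - 1) \<omega>))"
    using assms by (intro sum.cong refl tele) auto
  also have "\<dots> = real (Suc a2 - a1) * Y 1 \<omega> + (\<Sum>t=a1..a2. \<Sum>r=2..t. Y r \<omega> - Y (r - 1) \<omega>)"
    by (simp add: sum.distrib)
  finally show ?thesis
    using assms by (simp add: Ybar_def add_divide_distrib)
qed

lemma Ybar_diff_eq_window_diff:
  assumes "1 \<le> a1" "a1 \<le> a2" "1 \<le> b1" "b1 \<le> b2"
  shows "Ybar Y a1 a2 \<omega> - Ybar Y b1 b2 \<omega> = window_diff a1 a2 b1 b2 (\<lambda>r. Y r \<omega> - Y (r - 1) \<omega>)"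
  by (simp add: Ybar_telescope[OF assms(1,2)] Ybar_telescope[OF assms(3,4)] window_diff_def)

lemma (in group_dose) cversion_window_diff:
  assumes "\<And>r. r \<in> {2..T} \<Longrightarrow> cversion M (X r) G D h (f r)"
    and "\<And>r. r \<in> {2..T} \<Longrightarrow> integrable M (X r)" and "a2 \<le> T" "b2 \<le> T"
  shows "cversion M (\<lambda>\<omega>. window_diff a1 a2 b1 b2 (\<lambda>r. X r \<omega>)) G D h
           (\<lambda>d. window_diff a1 a2 b1 b2 (\<lambda>r. f r d))"
  unfolding window_diff_def using assms
  by (intro cversion_diff cversion_scale cversion_sum integrable_divide Bochner_Integration.integrable_sum)
    auto

lemma cexp_diff:
  assumes "A \<in> sets M" "integrable M X" "integrable M X'"
  shows "cexp M (\<lambda>\<omega>. X \<omega> - X' \<omega>) A = cexp M X A - cexp M X' A"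
  using integrable_mult_indicator[OF assms(1,2)] integrable_mult_indicator[OF assms(1,3)]
  by (simp add: cexp_def left_diff_distrib diff_divide_distrib mult.commute[of "indicator A _"])

lemma cexp_sum:
  assumes "A \<in> sets M" "\<And>i. i \<in> I \<Longrightarrow> integrable M (X i)"
  shows "cexp M (\<lambda>\<omega>. \<Sum>i\<in>I. X i \<omega>) A = (\<Sum>i\<in>I. cexp M (X i) A)"
proof -
  have "integrable M (\<lambda>\<omega>. X i \<omega> * indicator A \<omega>)" if "i \<in> I" for i
    using integrable_mult_indicator[OF assms(1) assms(2)[OF that]] by (simp add: mult.commute)
  then show ?thesis
    unfolding cexp_def sum_distrib_right sum_divide_distrib[symmetric]
    by (subst Bochner_Integration.integral_sum) auto
qed

lemma cexp_divide: "cexp M (\<lambda>\<omega>. X \<omega> / c) A = cexp M X A / c"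
  by (simp add: cexp_def)

lemma cexp_window_diff:
  assumes "A \<in> sets M" "\<And>r. r \<in> {2..T} \<Longrightarrow> integrable M (X r)" and "a2 \<le> T" "b2 \<le> T"
  shows "cexp M (\<lambda>\<omega>. window_diff a1 a2 b1 b2 (\<lambda>r. X r \<omega>)) A =
         window_diff a1 a2 b1 b2 (\<lambda>r. cexp M (X r) A)"
proof -
  have X: "integrable M (X r)" if "2 \<le> r" "r \<le> t" "t \<le> a2 \<or> t \<le> b2" for r t
    using that assms by auto
  have *: "cexp M (\<lambda>\<omega>. \<Sum>t=c1..c2. \<Sum>r=2..t. X r \<omega>) A = (\<Sum>t=c1..c2. \<Sum>r=2..t. cexp M (X r) A)"
    if "c2 \<le> T" for c1 c2
  proof -
    have "cexp M (\<lambda>\<omega>. \<Sum>t=c1..c2. \<Sum>r=2..t. X r \<omega>) A = (\<Sum>t=c1..c2. cexp M (\<lambda>\<omega>. \<Sum>r=2..t. X r \<omega>) A)"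
      using assms that by (intro cexp_sum Bochner_Integration.integrable_sum) auto
    also have "\<dots> = (\<Sum>t=c1..c2. \<Sum>r=2..t. cexp M (X r) A)"
      using assms that by (intro sum.cong refl cexp_sum) auto
    finally show ?thesis .
  qed
  show ?thesis
    unfolding window_diff_def using assms
    by (subst cexp_diff) (auto simp: cexp_divide * intro!: Bochner_Integration.integrable_sum X)
qed

section \<open>Differentiating along the diagonal\<close>

text \<open>The map is restricted to three paths through (l, l) with velocities (1, 0), (0, 1) and
  (1, 1), and its joint derivative is linear in the velocity. As the interval is nondegenerate,
  derivatives within it are unique even at the endpoints, so \<open>dw\<close> returns them.\<close>

lemma ATT_diagonal_has_vector_derivative:
  fixes ATT :: "nat \<Rightarrow> nat \<Rightarrow> nat \<Rightarrow> real \<Rightarrow> real \<Rightarrow> real"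
  assumes "ATT_diff dL dU ATT h t1 t2" "dL < dU" "l \<in> {dL..dU}"
  shows "((\<lambda>x. ATT t1 t2 h x x) has_vector_derivative ACRT_plus dL dU ATT h t1 t2 l)
           (at l within {dL..dU})"
proof -
  let ?S = "{dL..dU}" and ?F = "\<lambda>p. ATT t1 t2 h (fst p) (snd p)"
  obtain F' where F': "(?F has_derivative F') (at (l, l) within ?S \<times> ?S)"
    using assms(1,3) unfolding ATT_diff_def differentiable_on_def differentiable_def by blast
  interpret F': bounded_linear F' using F' by (rule has_derivative_bounded_linear)
  have comp: "((\<lambda>x. ?F (p x)) has_vector_derivative F' v) (at l within ?S)"
    if p: "(p has_derivative (\<lambda>x. x *\<^sub>R v)) (at l within ?S)" "p l = (l, l)" "p ` ?S \<subseteq> ?S \<times> ?S" for p v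
  proof -
    have "(?F has_derivative F') (at (p l) within p ` ?S)"
      using has_derivative_subset[OF F' p(3)] p(2) by simp
    from diff_chain_within[OF p(1) this] show ?thesis
      by (simp add: has_vector_derivative_def o_def F'.scaleR)
  qed
  have "((\<lambda>x. ?F (x, l)) has_vector_derivative F' (1, 0)) (at l within ?S)"
    by (rule comp) (use assms(3) in \<open>auto intro!: derivative_eq_intros\<close>)
  then have 1: "dw (\<lambda>x. ATT t1 t2 h x l) ?S l = F' (1, 0)"
    unfolding dw_def using assms(2,3) by (intro vector_derivative_within_closed_interval) simp_all
  have "((\<lambda>x. ?F (l, x)) has_vector_derivative F' (0, 1)) (at l within ?S)"
    by (rule comp) (use assms(3) in \<open>auto intro!: derivative_eq_intros\<close>)
  then have 2: "dw (\<lambda>x. ATT t1 t2 h l x) ?S l = F' (0, 1)"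
    unfolding dw_def using assms(2,3) by (intro vector_derivative_within_closed_interval) simp_all
  have "((\<lambda>x. ?F (x, x)) has_vector_derivative F' (1, 1)) (at l within ?S)"
    by (rule comp) (auto intro!: derivative_eq_intros)
  moreover have "F' (1, 1) = F' (1, 0) + F' (0, 1)"
    by (simp add: F'.add[symmetric])
  ultimately show ?thesis by (simp add: ACRT_plus_def 1 2)
qed

section \<open>Identification from parallel trends\<close>

text \<open>Stated for an arbitrary group h, since both g and k have to be expanded. The versions
  \<open>mDY\<close> are fixed once because \<open>piD\<close> depends on their choice.\<close>

locale staggered_did = group_dose M G D
  for M :: "'a measure" and G :: "'a \<Rightarrow> nat" and D :: "'a \<Rightarrow> real" +
  fixes T :: nat and Gs :: "nat set" and Yp :: "nat \<Rightarrow> nat \<Rightarrow> real \<Rightarrow> 'a \<Rightarrow> real"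
    and dL dU :: real and mDY :: "nat \<Rightarrow> nat \<Rightarrow> real \<Rightarrow> real"
  assumes G_pos: "h \<in> Gs \<Longrightarrow> measure M (evt M (\<lambda>\<omega>. G \<omega> = h)) > 0"
    and never_treated: "\<omega> \<in> space M \<Longrightarrow> D \<omega> = 0 \<longleftrightarrow> G \<omega> = Suc T"
    and dose_range: "\<omega> \<in> space M \<Longrightarrow> G \<omega> \<le> T \<Longrightarrow> D \<omega> \<in> {dL..dU}"
    and Y0_integrable: "t \<in> {1..T} \<Longrightarrow> integrable M (Y0 T Yp t)"
    and obsY_integrable: "t \<in> {1..T} \<Longrightarrow> integrable M (obsY T Yp G D t)"
    and dose_supp: "h \<in> Gs \<Longrightarrow> h \<le> T \<Longrightarrow> {dL..dU} \<subseteq> csupp M D (evt M (\<lambda>\<omega>. G \<omega> = h))"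
    and dL_pos: "0 < dL" and dL_less_dU: "dL < dU"
    and mDY_version: "h \<in> Gs \<Longrightarrow> h \<le> T \<Longrightarrow> t \<in> {2..T} \<Longrightarrow>
          cversion M (\<lambda>\<omega>. obsY T Yp G D t \<omega> - obsY T Yp G D (t - 1) \<omega>) G D h (mDY t h)"
    and mDY_C1: "h \<in> Gs \<Longrightarrow> h \<le> T \<Longrightarrow> t \<in> {2..T} \<Longrightarrow> C1_on_interval (mDY t h) dL dU"
    and PT: "h \<in> Gs \<Longrightarrow> t \<in> {2..T} \<Longrightarrow>
          cversion M (\<lambda>\<omega>. Y0 T Yp t \<omega> - Y0 T Yp (t - 1) \<omega>) G D h
            (\<lambda>_. cexp M (\<lambda>\<omega>. Y0 T Yp t \<omega> - Y0 T Yp (t - 1) \<omega>) (evt M (\<lambda>\<omega>. D \<omega> = 0)))"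
begin

abbreviation Ydiff :: "nat \<Rightarrow> nat \<Rightarrow> nat \<Rightarrow> nat \<Rightarrow> 'a \<Rightarrow> real" where
  "Ydiff a1 a2 b1 b2 \<equiv> \<lambda>\<omega>. Ybar (obsY T Yp G D) a1 a2 \<omega> - Ybar (obsY T Yp G D) b1 b2 \<omega>"

abbreviation Y0diff :: "nat \<Rightarrow> nat \<Rightarrow> nat \<Rightarrow> nat \<Rightarrow> 'a \<Rightarrow> real" where
  "Y0diff a1 a2 b1 b2 \<equiv> \<lambda>\<omega>. Ybar (Y0 T Yp) a1 a2 \<omega> - Ybar (Y0 T Yp) b1 b2 \<omega>"

abbreviation cexp0 :: "('a \<Rightarrow> real) \<Rightarrow> real" where
  "cexp0 X \<equiv> cexp M X (evt M (\<lambda>\<omega>. D \<omega> = 0))"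

definition windows :: "nat \<Rightarrow> nat \<Rightarrow> nat \<Rightarrow> nat \<Rightarrow> bool" where
  "windows a1 a2 b1 b2 \<longleftrightarrow> 1 \<le> a1 \<and> a1 \<le> a2 \<and> a2 \<le> T \<and> 1 \<le> b1 \<and> b1 \<le> b2 \<and> b2 \<le> T"

lemma sets_evt_D0: "evt M (\<lambda>\<omega>. D \<omega> = 0) \<in> sets M"
  unfolding evt_def by measurable

lemma Ydiff_integrable:
  assumes "windows a1 a2 b1 b2"
  shows "integrable M (Ydiff a1 a2 b1 b2)" "integrable M (Y0diff a1 a2 b1 b2)"
  unfolding Ybar_def using assms
  by (auto simp: windows_def intro!: Bochner_Integration.integrable_diff integrable_divide
      Bochner_Integration.integrable_sum obsY_integrable Y0_integrable)

lemma cversion_Ydiff: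
  assumes "windows a1 a2 b1 b2" "h \<in> Gs" "h \<le> T"
  shows "cversion M (Ydiff a1 a2 b1 b2) G D h (\<lambda>d. window_diff a1 a2 b1 b2 (\<lambda>r. mDY r h d))"
proof -
  have eq: "Ydiff a1 a2 b1 b2 = (\<lambda>\<omega>. window_diff a1 a2 b1 b2
      (\<lambda>r. obsY T Yp G D r \<omega> - obsY T Yp G D (r - 1) \<omega>))"
    using assms(1) by (intro ext Ybar_diff_eq_window_diff) (auto simp: windows_def)
  show ?thesis
    unfolding eq using assms
    by (intro cversion_window_diff[where T = T] mDY_version Bochner_Integration.integrable_diff
        obsY_integrable) (auto simp: windows_def)
qed

text \<open>On {D = 0} the group is T + 1, later than every period of the windows, so observed and
  untreated outcomes coincide.\<close>

lemma cexp0_Ydiff_eq: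
  assumes "windows a1 a2 b1 b2"
  shows "cexp0 (Ydiff a1 a2 b1 b2) = cexp0 (Y0diff a1 a2 b1 b2)"
proof -
  have "Ydiff a1 a2 b1 b2 \<omega> * indicator (evt M (\<lambda>\<omega>. D \<omega> = 0)) \<omega> =
        Y0diff a1 a2 b1 b2 \<omega> * indicator (evt M (\<lambda>\<omega>. D \<omega> = 0)) \<omega>" if "\<omega> \<in> space M" for \<omega>
    using assms that never_treated[OF that]
    by (auto simp: evt_def indicator_def obsY_def Ybar_def windows_def)
  then show ?thesis
    unfolding cexp_def by (simp only: cong: Bochner_Integration.integral_cong)
qed

text \<open>Parallel trends is assumed period by period and extends to window averages by linearity.
  Its constant can be written with observed outcomes because those of the never treated are
  untreated.\<close>

lemma cversion_Y0diff:
  assumes w: "windows a1 a2 b1 b2" and h: "h \<in> Gs"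
  shows "cversion M (Y0diff a1 a2 b1 b2) G D h (\<lambda>_. cexp0 (Ydiff a1 a2 b1 b2))"
proof -
  have eq: "Y0diff a1 a2 b1 b2 = (\<lambda>\<omega>. window_diff a1 a2 b1 b2
      (\<lambda>r. Y0 T Yp r \<omega> - Y0 T Yp (r - 1) \<omega>))"
    using w by (intro ext Ybar_diff_eq_window_diff) (auto simp: windows_def)
  have int: "integrable M (\<lambda>\<omega>. Y0 T Yp r \<omega> - Y0 T Yp (r - 1) \<omega>)" if "r \<in> {2..T}" for r
    using that by (intro Bochner_Integration.integrable_diff Y0_integrable) auto
  have "cexp0 (Ydiff a1 a2 b1 b2) =
      window_diff a1 a2 b1 b2 (\<lambda>r. cexp0 (\<lambda>\<omega>. Y0 T Yp r \<omega> - Y0 T Yp (r - 1) \<omega>))"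
    unfolding cexp0_Ydiff_eq[OF w] eq
    using w by (intro cexp_window_diff[where T = T] sets_evt_D0 int) (auto simp: windows_def)
  then show ?thesis
    unfolding eq using w
    by (simp only:, intro cversion_window_diff[where T = T] PT[OF h] int) (auto simp: windows_def)
qed

lemma piD_eq_window_diff:
  "piD M T Yp G D mDY a1 a2 b1 b2 h d =
     window_diff a1 a2 b1 b2 (\<lambda>r. mDY r h d) - cexp0 (Ydiff a1 a2 b1 b2)"
  by (simp add: piD_def Let_def window_diff_def)

text \<open>Observed change minus untreated change is the effect of treatment on the contrast A - B.
  The position of the windows relative to h enters only when this effect is compared with
  \<open>ATT\<close>.\<close>

lemma cversion_piD:
  assumes "windows a1 a2 b1 b2" "h \<in> Gs" "h \<le> T"
  shows "cversion M (\<lambda>\<omega>. Ydiff a1 a2 b1 b2 \<omega> - Y0diff a1 a2 b1 b2 \<omega>) G D h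
           (piD M T Yp G D mDY a1 a2 b1 b2 h)"
proof -
  have eq: "piD M T Yp G D mDY a1 a2 b1 b2 h =
      (\<lambda>d. window_diff a1 a2 b1 b2 (\<lambda>r. mDY r h d) - cexp0 (Ydiff a1 a2 b1 b2))"
    by (rule ext) (rule piD_eq_window_diff)
  show ?thesis
    unfolding eq using assms by (intro cversion_diff cversion_Ydiff cversion_Y0diff Ydiff_integrable)
qed

lemma C1_window_diff:
  assumes "windows a1 a2 b1 b2" "h \<in> Gs" "h \<le> T"
  obtains f' where "continuous_on {dL..dU} f'"
    and "\<And>x. x \<in> {dL..dU} \<Longrightarrow>
      ((\<lambda>d. window_diff a1 a2 b1 b2 (\<lambda>r. mDY r h d)) has_real_derivative f' x) (at x within {dL..dU})"
proof -
  have "\<forall>r\<in>{2..T}. \<exists>m. (\<forall>x\<in>{dL..dU}. (mDY r h has_real_derivative m x) (at x within {dL..dU}))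
      \<and> continuous_on {dL..dU} m"
    using mDY_C1[OF assms(2,3)] by (simp add: C1_on_interval_def)
  then obtain m where m:
    "\<And>r x. 2 \<le> r \<Longrightarrow> r \<le> T \<Longrightarrow> x \<in> {dL..dU} \<Longrightarrow> (mDY r h has_real_derivative m r x) (at x within {dL..dU})"
    "\<And>r. 2 \<le> r \<Longrightarrow> r \<le> T \<Longrightarrow> continuous_on {dL..dU} (m r)"
    by (metis (no_types, lifting) bchoice atLeastAtMost_iff)
  show ?thesis
  proof (rule that[of "\<lambda>x. window_diff a1 a2 b1 b2 (\<lambda>r. m r x)"])
    show "continuous_on {dL..dU} (\<lambda>x. window_diff a1 a2 b1 b2 (\<lambda>r. m r x))"
      unfolding window_diff_def divide_inverse using assms(1)
      by (intro continuous_intros m(2)) (auto simp: windows_def)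
    show "((\<lambda>d. window_diff a1 a2 b1 b2 (\<lambda>r. mDY r h d)) has_real_derivative
        window_diff a1 a2 b1 b2 (\<lambda>r. m r x)) (at x within {dL..dU})" if "x \<in> {dL..dU}" for x
      unfolding window_diff_def using assms(1) that
      by (intro DERIV_diff DERIV_cdivide DERIV_sum m(1)) (auto simp: windows_def)
  qed
qed

lemma dw_eq:
  assumes "(f has_vector_derivative y) (at x within {dL..dU})" "x \<in> {dL..dU}"
  shows "dw f {dL..dU} x = y"
  unfolding dw_def using dL_less_dU assms(2,1) by (rule vector_derivative_within_closed_interval)

text \<open>\<open>piD\<close> is this \<open>window_diff\<close> minus a constant, so they share
  their slopes; naming the slope by \<open>dw\<close> gives it the form used in the theorem.\<close>

lemma window_diff_has_derivative_dw_piD: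
  assumes "windows a1 a2 b1 b2" "h \<in> Gs" "h \<le> T"
  shows "continuous_on {dL..dU} (dw (piD M T Yp G D mDY a1 a2 b1 b2 h) {dL..dU})"
    and "x \<in> {dL..dU} \<Longrightarrow> ((\<lambda>d. window_diff a1 a2 b1 b2 (\<lambda>r. mDY r h d)) has_real_derivative
           dw (piD M T Yp G D mDY a1 a2 b1 b2 h) {dL..dU} x) (at x within {dL..dU})"
proof -
  obtain f' where f': "continuous_on {dL..dU} f'" "\<And>x. x \<in> {dL..dU} \<Longrightarrow>
      ((\<lambda>d. window_diff a1 a2 b1 b2 (\<lambda>r. mDY r h d)) has_real_derivative f' x) (at x within {dL..dU})"
    using C1_window_diff[OF assms] by blast
  have "dw (piD M T Yp G D mDY a1 a2 b1 b2 h) {dL..dU} x = f' x" if "x \<in> {dL..dU}" for x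
    unfolding piD_eq_window_diff
    by (intro dw_eq that has_real_derivative_iff_has_vector_derivative[THEN iffD1])
      (auto intro!: derivative_eq_intros f'(2)[OF that])
  then show "continuous_on {dL..dU} (dw (piD M T Yp G D mDY a1 a2 b1 b2 h) {dL..dU})"
    and "x \<in> {dL..dU} \<Longrightarrow> ((\<lambda>d. window_diff a1 a2 b1 b2 (\<lambda>r. mDY r h d)) has_real_derivative
           dw (piD M T Yp G D mDY a1 a2 b1 b2 h) {dL..dU} x) (at x within {dL..dU})"
    using f' continuous_on_cong[of "{dL..dU}" "{dL..dU}" "dw (piD M T Yp G D mDY a1 a2 b1 b2 h) {dL..dU}" f']
    by simp_all
qed

text \<open>Both sides are continuous versions of the same conditional mean, and the conditional support
  of the dose is the whole interval.\<close>
lemma ATT_diagonal_eq_piD: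
  assumes w: "windows a1 a2 b1 b2" and h: "h \<in> Gs" "h \<le> T" and ab: "h \<le> a1" "b2 < h"
    and ver: "ATT_version M T Yp G D dL dU ATT h a1 a2" and diff: "ATT_diff dL dU ATT h a1 a2"
    and l: "l \<in> {dL..dU}"
  shows "ATT a1 a2 h l l = piD M T Yp G D mDY a1 a2 b1 b2 h l"
proof (rule cversion_unique_on_csupp[where f = "\<lambda>l. ATT a1 a2 h l l"])
  show "cversion M (\<lambda>\<omega>. Ydiff a1 a2 b1 b2 \<omega> - Y0diff a1 a2 b1 b2 \<omega>) G D h (\<lambda>l. ATT a1 a2 h l l)"
  proof (rule cversion_cong)
    show "cversion M (Ybar (\<lambda>t \<omega>. Yp t h (D \<omega>) \<omega> - Y0 T Yp t \<omega>) a1 a2) G D h (\<lambda>l. ATT a1 a2 h l l)"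
      using ver by (simp add: ATT_version_def)
    \<comment> \<open>Group h is treated throughout A and untreated throughout B: the B averages
      cancel, and A leaves the effect at the realised dose.\<close>
    show "Ybar (\<lambda>t \<omega>. Yp t h (D \<omega>) \<omega> - Y0 T Yp t \<omega>) a1 a2 \<omega> =
        Ydiff a1 a2 b1 b2 \<omega> - Y0diff a1 a2 b1 b2 \<omega>" if "G \<omega> = h" for \<omega>
      using ab that by (simp add: Ybar_def obsY_def sum_subtractf diff_divide_distrib)
  qed
  show "cversion M (\<lambda>\<omega>. Ydiff a1 a2 b1 b2 \<omega> - Y0diff a1 a2 b1 b2 \<omega>) G D h
      (piD M T Yp G D mDY a1 a2 b1 b2 h)"
    using w h by (rule cversion_piD)
  show "continuous_on {dL..dU} (\<lambda>l. ATT a1 a2 h l l)"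
    using ATT_diagonal_has_vector_derivative[OF diff dL_less_dU]
    unfolding continuous_on_eq_continuous_within by (blast intro: has_vector_derivative_continuous)
  have "continuous_on {dL..dU} (\<lambda>d. window_diff a1 a2 b1 b2 (\<lambda>r. mDY r h d))"
    using window_diff_has_derivative_dw_piD(2)[OF w h] by (rule DERIV_continuous_on)
  then show "continuous_on {dL..dU} (piD M T Yp G D mDY a1 a2 b1 b2 h)"
    unfolding piD_eq_window_diff[abs_def] by (intro continuous_intros)
qed (use dose_range dose_supp[OF h] h l in auto)

text \<open>Replaces the integrand of the theorem by the slope of \<open>piD\<close>, which is known
  to be continuous.\<close>

lemma ACRT_plus_eq_dw_piD:
  assumes "windows a1 a2 b1 b2" "h \<in> Gs" "h \<le> T" "h \<le> a1" "b2 < h"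
    and "ATT_version M T Yp G D dL dU ATT h a1 a2" "ATT_diff dL dU ATT h a1 a2"
    and l: "l \<in> {dL..dU}"
  shows "ACRT_plus dL dU ATT h a1 a2 l = dw (piD M T Yp G D mDY a1 a2 b1 b2 h) {dL..dU} l"
proof -
  have "(piD M T Yp G D mDY a1 a2 b1 b2 h has_vector_derivative ACRT_plus dL dU ATT h a1 a2 l)
      (at l within {dL..dU})"
    using ATT_diagonal_has_vector_derivative[OF assms(7) dL_less_dU l]
    by (rule has_vector_derivative_transform[OF l, rotated])
      (simp add: ATT_diagonal_eq_piD[OF assms(1-7)])
  then show ?thesis using dw_eq l by simp
qed

section \<open>Layer-cake expansions within a group\<close>

text \<open>Layer cake with the indicator of group h, divided by its probability. The function f is
  not tied to h because POST - PRE needs the slope of group g weighted by the doses of group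
  k.\<close>

lemma cexp_C1_expansion:
  assumes h: "h \<in> Gs" "h \<le> T" and cont: "continuous_on {dL..dU} f'"
    and deriv: "\<And>x. x \<in> {dL..dU} \<Longrightarrow> (f has_real_derivative f' x) (at x within {dL..dU})"
  shows "((\<lambda>l. cprob M (evt M (\<lambda>\<omega>. D \<omega> \<ge> l)) (evt M (\<lambda>\<omega>. G \<omega> = h)) * f' l) has_integral
           cexp M (\<lambda>\<omega>. f (D \<omega>)) (evt M (\<lambda>\<omega>. G \<omega> = h)) - f dL) {dL..dU}"
proof -
  let ?A = "evt M (\<lambda>\<omega>. G \<omega> = h)"
  have tail: "(\<integral>\<omega>. indicator ?A \<omega> * indicator {l..} (D \<omega>) \<partial>M) =
      measure M (evt M (\<lambda>\<omega>. D \<omega> \<ge> l) \<inter> ?A)" for l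
  proof -
    have "(\<integral>\<omega>. indicator ?A \<omega> * indicator {l..} (D \<omega>) \<partial>M) =
        (\<integral>\<omega>. indicator (evt M (\<lambda>\<omega>. D \<omega> \<ge> l) \<inter> ?A) \<omega> \<partial>M :: real)"
      by (rule Bochner_Integration.integral_cong) (auto simp: evt_def indicator_def)
    also have "\<dots> = measure M (evt M (\<lambda>\<omega>. D \<omega> \<ge> l) \<inter> ?A)"
      by (simp add: Int_assoc)
    finally show ?thesis .
  qed
  have "((\<lambda>l. (\<integral>\<omega>. indicator ?A \<omega> * indicator {l..} (D \<omega>) \<partial>M) * f' l) has_integral
      (\<integral>\<omega>. indicator ?A \<omega> * f (D \<omega>) \<partial>M) - f dL * (\<integral>\<omega>. indicator ?A \<omega> \<partial>M)) {dL..dU}"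
  proof (rule integral_mult_C1_comp)
    show "D \<omega> \<in> {dL..dU}" if "\<omega> \<in> space M" "indicat_real ?A \<omega> \<noteq> 0" for \<omega>
      using that dose_range[of \<omega>] h by (auto simp: evt_def indicator_def split: if_splits)
  qed (use cont deriv sets_evt_G in \<open>auto simp: finite_measure_axioms less_top[symmetric]\<close>)
  from has_integral_divide[OF this, of "measure M ?A"]
  have "((\<lambda>l. cprob M (evt M (\<lambda>\<omega>. D \<omega> \<ge> l)) ?A * f' l) has_integral
      ((\<integral>\<omega>. indicator ?A \<omega> * f (D \<omega>) \<partial>M) - f dL * measure M ?A) / measure M ?A) {dL..dU}"
    by (simp add: tail cprob_def)
  then show ?thesis
    using G_pos[OF h(1)] by (simp add: cexp_def diff_divide_distrib mult.commute[of "f (D _)"])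
qed

text \<open>The version property on the whole group replaces the mean of f(D) by that of the outcome
  contrast; the boundary value of f splits into \<open>piD\<close> at \<open>dL\<close> and the
  never-treated mean.\<close>

lemma cexp_Ydiff_expansion:
  assumes w: "windows a1 a2 b1 b2" and h: "h \<in> Gs" "h \<le> T"
  shows "((\<lambda>l. cprob M (evt M (\<lambda>\<omega>. D \<omega> \<ge> l)) (evt M (\<lambda>\<omega>. G \<omega> = h))
             * dw (piD M T Yp G D mDY a1 a2 b1 b2 h) {dL..dU} l) has_integral
           cexp M (Ydiff a1 a2 b1 b2) (evt M (\<lambda>\<omega>. G \<omega> = h)) - cexp0 (Ydiff a1 a2 b1 b2)
             - piD M T Yp G D mDY a1 a2 b1 b2 h dL) {dL..dU}"
  using cexp_C1_expansion[OF h window_diff_has_derivative_dw_piD[OF w h]]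
    cversion_integral_eq(2)[OF cversion_Ydiff[OF w h]]
  by (simp add: cexp_def[of M _ "evt M (\<lambda>\<omega>. G \<omega> = h)"] piD_eq_window_diff)

text \<open>The outcome contrast may be replaced by its version f(D) even after multiplication by D,
  so the covariance is a mean of Z f(D) over the group. The tail integral of Z, divided by the
  probability of the group, is the numerator of \<open>w1within\<close>.\<close>

lemma ccov_Ydiff_expansion:
  assumes w: "windows a1 a2 b1 b2" and h: "h \<in> Gs" "h \<le> T"
  shows "((\<lambda>l. (cexp M D (evt M (\<lambda>\<omega>. G \<omega> = h \<and> D \<omega> \<ge> l)) - cexp M D (evt M (\<lambda>\<omega>. G \<omega> = h)))
             * cprob M (evt M (\<lambda>\<omega>. D \<omega> \<ge> l)) (evt M (\<lambda>\<omega>. G \<omega> = h))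
             * dw (piD M T Yp G D mDY a1 a2 b1 b2 h) {dL..dU} l) has_integral
           ccov M (Ydiff a1 a2 b1 b2) D (evt M (\<lambda>\<omega>. G \<omega> = h))) {dL..dU}"
proof -
  let ?A = "evt M (\<lambda>\<omega>. G \<omega> = h)" and ?f = "\<lambda>d. window_diff a1 a2 b1 b2 (\<lambda>r. mDY r h d)"
  let ?f' = "dw (piD M T Yp G D mDY a1 a2 b1 b2 h) {dL..dU}" and ?X = "Ydiff a1 a2 b1 b2"
  define m where "m = cexp M D ?A"
  define Z where "Z \<omega> = (D \<omega> - m) * indicator ?A \<omega>" for \<omega>
  note v = cversion_Ydiff[OF w h]
  have D_in: "D \<omega> \<in> {dL..dU}" if "\<omega> \<in> space M" "G \<omega> = h" for \<omega>
    using that dose_range h by auto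
  have A_pos: "measure M ?A > 0" using G_pos[OF h(1)] .
  \<comment> \<open>On group h the dose lies between \<open>dL\<close> > 0 and \<open>dU\<close>, so
    multiplying by D preserves integrability.\<close>
  have mult_D: "integrable M (\<lambda>\<omega>. V \<omega> * indicator ?A \<omega> * D \<omega>)"
    if V: "integrable M (\<lambda>\<omega>. V \<omega> * indicator ?A \<omega>)" for V :: "'a \<Rightarrow> real"
  proof (rule Bochner_Integration.integrable_bound)
    show "integrable M (\<lambda>\<omega>. V \<omega> * indicator ?A \<omega> * dU)" using V by simp
    show "(\<lambda>\<omega>. V \<omega> * indicator ?A \<omega> * D \<omega>) \<in> borel_measurable M"
      using borel_measurable_integrable[OF V] by measurable
    show "AE \<omega> in M. norm (V \<omega> * indicator ?A \<omega> * D \<omega>) \<le> norm (V \<omega> * indicator ?A \<omega> * dU)"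
      using D_in dL_pos by (intro AE_I2) (force simp: abs_mult evt_def indicator_def intro!: mult_left_mono)
  qed
  have one_A: "integrable M (\<lambda>\<omega>. 1 * indicator ?A \<omega> :: real)"
    using sets_evt_G by (simp add: less_top[symmetric])
  have D_A: "integrable M (\<lambda>\<omega>. D \<omega> * indicator ?A \<omega>)"
    using mult_D[OF one_A] by (simp add: mult.commute)
  have Z_int: "integrable M Z"
    using D_A one_A by (simp add: Z_def[abs_def] left_diff_distrib)
  have Z_0: "(\<integral>\<omega>. Z \<omega> \<partial>M) = 0"
    using D_A one_A A_pos by (simp add: Z_def[abs_def] left_diff_distrib m_def cexp_def)
  have X_A: "integrable M (\<lambda>\<omega>. ?X \<omega> * indicator ?A \<omega>)"
    by (rule integrable_mult_indicator_G[OF Ydiff_integrable(1)[OF w]])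
  note f_A = cversion_integral_eq[OF v]
  have X_f: "(\<integral>\<omega>. ?X \<omega> * indicator ?A \<omega> * D \<omega> \<partial>M) = (\<integral>\<omega>. ?f (D \<omega>) * indicator ?A \<omega> * D \<omega> \<partial>M)"
    using cversion_integral_mult_dose[OF v Ydiff_integrable(1)[OF w] D_in] mult_D[OF X_A] mult_D[OF f_A(1)]
    by (simp add: left_diff_distrib)
  have cov: "ccov M ?X D ?A = (\<integral>\<omega>. Z \<omega> * ?f (D \<omega>) \<partial>M) / measure M ?A"
  proof -
    \<comment> \<open>c stands for the mean of the contrast; it multiplies Z, which integrates to 0,
      so any constant will do.\<close>
    have "(\<integral>\<omega>. (?X \<omega> - c) * (D \<omega> - m) * indicator ?A \<omega> \<partial>M) = (\<integral>\<omega>. Z \<omega> * ?f (D \<omega>) \<partial>M)" for c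
    proof -
      have "(\<integral>\<omega>. (?X \<omega> - c) * (D \<omega> - m) * indicator ?A \<omega> \<partial>M) =
          (\<integral>\<omega>. (?X \<omega> * indicator ?A \<omega> * D \<omega> - m * (?X \<omega> * indicator ?A \<omega>)) - c * Z \<omega> \<partial>M)"
        by (rule Bochner_Integration.integral_cong) (auto simp: Z_def algebra_simps)
      also have "\<dots> = (\<integral>\<omega>. ?f (D \<omega>) * indicator ?A \<omega> * D \<omega> \<partial>M) - m * (\<integral>\<omega>. ?f (D \<omega>) * indicator ?A \<omega> \<partial>M)"
        using mult_D[OF X_A] X_A Z_int by (simp add: Z_0 X_f f_A(2))
      also have "\<dots> = (\<integral>\<omega>. ?f (D \<omega>) * indicator ?A \<omega> * D \<omega> - m * (?f (D \<omega>) * indicator ?A \<omega>) \<partial>M)"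
        using mult_D[OF f_A(1)] f_A(1) by simp
      also have "\<dots> = (\<integral>\<omega>. Z \<omega> * ?f (D \<omega>) \<partial>M)"
        by (rule Bochner_Integration.integral_cong) (auto simp: Z_def algebra_simps)
      finally show ?thesis .
    qed
    then show ?thesis by (simp add: ccov_def cexp_def[of M _ ?A] m_def)
  qed
  have tail: "(\<integral>\<omega>. Z \<omega> * indicator {l..} (D \<omega>) \<partial>M) / measure M ?A =
      (cexp M D (evt M (\<lambda>\<omega>. G \<omega> = h \<and> D \<omega> \<ge> l)) - m) * cprob M (evt M (\<lambda>\<omega>. D \<omega> \<ge> l)) ?A" for l
  proof -
    let ?B = "evt M (\<lambda>\<omega>. G \<omega> = h \<and> D \<omega> \<ge> l)"
    have B: "?B \<in> sets M" using sets_evt[of "{l..}" h] by simp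
    have B_eq: "evt M (\<lambda>\<omega>. D \<omega> \<ge> l) \<inter> ?A = ?B" by (auto simp: evt_def)
    have D_B: "integrable M (\<lambda>\<omega>. D \<omega> * indicator ?B \<omega>)"
    proof (rule Bochner_Integration.integrable_bound[OF D_A])
      show "(\<lambda>\<omega>. D \<omega> * indicator ?B \<omega>) \<in> borel_measurable M" using B by measurable
    qed (auto simp: evt_def indicator_def)
    have "(\<integral>\<omega>. Z \<omega> * indicator {l..} (D \<omega>) \<partial>M) = (\<integral>\<omega>. D \<omega> * indicator ?B \<omega> - m * indicator ?B \<omega> \<partial>M)"
      by (rule Bochner_Integration.integral_cong) (auto simp: Z_def evt_def indicator_def)
    also have "\<dots> = (\<integral>\<omega>. D \<omega> * indicator ?B \<omega> \<partial>M) - m * measure M ?B"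
      using D_B B by (subst Bochner_Integration.integral_diff) (auto simp: less_top[symmetric])
    \<comment> \<open>If the tail event is null, \<open>cexp\<close> divides by 0 and returns 0; the
      identity survives because the integral on the left vanishes as well.\<close>
    also have "(\<integral>\<omega>. D \<omega> * indicator ?B \<omega> \<partial>M) = cexp M D ?B * measure M ?B"
    proof (cases "measure M ?B = 0")
      case True
      then have "AE \<omega> in M. D \<omega> * indicator ?B \<omega> = 0"
        using prob_eq_0[OF B] by (auto elim!: eventually_mono)
      then have "(\<integral>\<omega>. D \<omega> * indicator ?B \<omega> \<partial>M) = 0" by (rule integral_eq_zero_AE)
      with True show ?thesis by simp
    qed (simp add: cexp_def)
    finally show ?thesis by (simp add: cprob_def B_eq left_diff_distrib)
  qed
  have "((\<lambda>l. (\<integral>\<omega>. Z \<omega> * indicator {l..} (D \<omega>) \<partial>M) * ?f' l) has_integral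
      (\<integral>\<omega>. Z \<omega> * ?f (D \<omega>) \<partial>M) - ?f dL * (\<integral>\<omega>. Z \<omega> \<partial>M)) {dL..dU}"
  proof (rule integral_mult_C1_comp)
    show "D \<omega> \<in> {dL..dU}" if "\<omega> \<in> space M" "Z \<omega> \<noteq> 0" for \<omega>
      using that D_in[of \<omega>] by (auto simp: Z_def evt_def indicator_def split: if_splits)
  qed (use window_diff_has_derivative_dw_piD[OF w h] Z_int in
      \<open>auto simp: finite_measure_axioms\<close>)
  from has_integral_divide[OF this, of "measure M ?A"]
  show ?thesis
    unfolding cov m_def[symmetric] tail[symmetric] by (simp add: Z_0)
qed

text \<open>While group h is untreated, parallel trends alone fixes its mean change, whatever its
  doses. This serves group k in MID - PRE.\<close>

lemma cexp_Ydiff_untreated: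
  assumes w: "windows a1 a2 b1 b2" and h: "h \<in> Gs" and lt: "a2 < h" "b2 < h"
  shows "cexp M (Ydiff a1 a2 b1 b2) (evt M (\<lambda>\<omega>. G \<omega> = h)) = cexp0 (Ydiff a1 a2 b1 b2)"
proof -
  let ?A = "evt M (\<lambda>\<omega>. G \<omega> = h)"
  have "(\<integral>\<omega>. Ydiff a1 a2 b1 b2 \<omega> * indicator ?A \<omega> \<partial>M) = (\<integral>\<omega>. Y0diff a1 a2 b1 b2 \<omega> * indicator ?A \<omega> \<partial>M)"
    using lt by (intro Bochner_Integration.integral_cong)
      (auto simp: evt_def indicator_def obsY_def Ybar_def)
  also have "\<dots> = (\<integral>\<omega>. cexp0 (Ydiff a1 a2 b1 b2) * indicator ?A \<omega> \<partial>M)"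
    by (rule cversion_integral_eq(2)[OF cversion_Y0diff[OF w h]])
  also have "\<dots> = cexp0 (Ydiff a1 a2 b1 b2) * measure M ?A"
    by (simp add:)
  finally show ?thesis using G_pos[OF h] by (simp add: cexp_def[of M _ ?A])
qed

end

section \<open>The four comparisons\<close>

theorem mainTheorem16:
  fixes M :: "'a measure" and T :: nat and Gs :: "nat set"
    and G :: "'a \<Rightarrow> nat" and D :: "'a \<Rightarrow> real"
    and Yp :: "nat \<Rightarrow> nat \<Rightarrow> real \<Rightarrow> 'a \<Rightarrow> real"
    and dL dU :: real
    and mDY :: "nat \<Rightarrow> nat \<Rightarrow> real \<Rightarrow> real"
    and ATT :: "nat \<Rightarrow> nat \<Rightarrow> nat \<Rightarrow> real \<Rightarrow> real \<Rightarrow> real"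
    and g k :: nat
  assumes prob: "prob_space M"
    and Gs_sub: "Gs \<subseteq> {2..Suc T}"
    and G_meas: "G \<in> measurable M (count_space UNIV)"
    and D_meas: "D \<in> borel_measurable M"
    and G_in: "\<forall>\<omega>\<in>space M. G \<omega> \<in> Gs"
    and G_pos: "\<forall>h\<in>Gs. measure M (evt M (\<lambda>\<omega>. G \<omega> = h)) > 0"
    and D_G: "\<forall>\<omega>\<in>space M. (D \<omega> = 0 \<longleftrightarrow> G \<omega> = Suc T) \<and> (G \<omega> \<le> T \<longrightarrow> D \<omega> \<in> {dL..dU})"
    and moments: "\<forall>t\<in>{1..T}. \<forall>h\<in>Gs. \<forall>d\<in>insert 0 {dL..dU}.
                    Yp t h d \<in> borel_measurable M \<and> integrable M (\<lambda>\<omega>. (Yp t h d \<omega>)\<^sup>2)"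
    and obs_moments: "\<forall>t\<in>{1..T}. obsY T Yp G D t \<in> borel_measurable M \<and>
                        integrable M (\<lambda>\<omega>. (obsY T Yp G D t \<omega>)\<^sup>2)"
    and A2a_supp: "csupp M D (space M) = insert 0 {dL..dU}"
    and A2a_D0: "measure M (evt M (\<lambda>\<omega>. D \<omega> = 0)) > 0"
    and A2a_cond: "\<forall>h\<in>Gs. h \<le> T \<longrightarrow> {dL..dU} \<subseteq> csupp M D (evt M (\<lambda>\<omega>. G \<omega> = h))"
    and A2b: "0 < dL" "dL < dU"
    and A2c: "\<forall>h\<in>Gs. h \<le> T \<longrightarrow> (\<forall>t\<in>{2..T}.
                cversion M (\<lambda>\<omega>. obsY T Yp G D t \<omega> - obsY T Yp G D (t - 1) \<omega>) G D h (mDY t h)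
                \<and> C1_on_interval (mDY t h) dL dU)"
    and A3a: "\<forall>h\<in>Gs. \<forall>d\<in>insert 0 {dL..dU}. \<forall>t\<in>{1..T}. t < h \<longrightarrow>
                (\<forall>\<omega>\<in>space M. Yp t h d \<omega> = Y0 T Yp t \<omega>)"
    and A3b: "\<forall>\<omega>\<in>space M. Wt G D 1 \<omega> = 0 \<and>
                (\<forall>t\<in>{2..T}. \<forall>d\<in>{dL..dU}. Wt G D (t - 1) \<omega> = d \<longrightarrow> Wt G D t \<omega> = d)"
    and PT: "\<forall>h\<in>Gs. \<forall>t\<in>{2..T}.
               cversion M (\<lambda>\<omega>. Y0 T Yp t \<omega> - Y0 T Yp (t - 1) \<omega>) G D h
                 (\<lambda>_. cexp M (\<lambda>\<omega>. Y0 T Yp t \<omega> - Y0 T Yp (t - 1) \<omega>) (evt M (\<lambda>\<omega>. D \<omega> = 0)))"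
    and g_in: "g \<in> Gs" "g \<noteq> Suc T"
    and k_in: "k \<in> Gs" "k \<noteq> Suc T"
    and gk: "g < k"
    and ATT_ver: "ATT_version M T Yp G D dL dU ATT g g T"
                 "ATT_version M T Yp G D dL dU ATT g g (k - 1)"
                 "ATT_version M T Yp G D dL dU ATT g k T"
                 "ATT_version M T Yp G D dL dU ATT k k T"
    and ATT_dif: "ATT_diff dL dU ATT g g T"
                 "ATT_diff dL dU ATT g g (k - 1)"
                 "ATT_diff dL dU ATT g k T"
                 "ATT_diff dL dU ATT k k T"
  shows
    "deltaWITHIN M T Yp G D g =
       integral {dL..dU} (\<lambda>l. w1within M G D g l * ACRT_plus dL dU ATT g g T l)
     \<and> deltaMIDPRE M T Yp G D g k =
       integral {dL..dU} (\<lambda>l. w1 M G D g l * ACRT_plus dL dU ATT g g (k - 1) l)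
       + w0 M G D dL g * ATT g (k - 1) g dL dL / dL
     \<and> deltaPOSTMID M T Yp G D g k =
       integral {dL..dU} (\<lambda>l. w1 M G D k l * ACRT_plus dL dU ATT k k T l)
       + w0 M G D dL k * ATT k T k dL dL / dL
       - w0 M G D dL k * (piAB M T Yp G D k T 1 (g - 1) g - piAB M T Yp G D g (k - 1) 1 (g - 1) g) / dL
     \<and> (cexp M D (evt M (\<lambda>\<omega>. G \<omega> = g)) \<noteq> cexp M D (evt M (\<lambda>\<omega>. G \<omega> = k)) \<longrightarrow>
        deltaPOSTPRE M T Yp G D g k =
          integral {dL..dU} (\<lambda>l. w1across M G D g k l * ACRT_plus dL dU ATT g k T l)
          - (integral {dL..dU} (\<lambda>l. w1across_t M G D g k l *
                (dw (piD M T Yp G D mDY k T 1 (g - 1) k) {dL..dU} l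
                 - dw (piD M T Yp G D mDY k T 1 (g - 1) g) {dL..dU} l))
             + w0across_t M G D dL g k *
                (piD M T Yp G D mDY k T 1 (g - 1) k dL - piD M T Yp G D mDY k T 1 (g - 1) g dL) / dL))"
proof -
  let ?cG = "\<lambda>h. evt M (\<lambda>\<omega>. G \<omega> = h)"
  interpret P: prob_space M by (rule prob)
  \<comment> \<open>Y_t(0) is the potential outcome of group T + 1, and \<open>moments\<close>
    covers only groups in \<open>Gs\<close>; {D = 0} has positive mass, so some unit belongs to that
    group.\<close>
  have never: "Suc T \<in> Gs"
  proof -
    have "evt M (\<lambda>\<omega>. D \<omega> = 0) \<noteq> {}" using A2a_D0 by force
    then show ?thesis using D_G G_in by (force simp: evt_def)
  qed
  interpret S: staggered_did M G D T Gs Yp dL dU mDY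
  proof
    show "integrable M (Y0 T Yp t)" if "t \<in> {1..T}" for t
      using moments[rule_format, OF that never, of 0] unfolding Y0_def[abs_def]
      by (blast intro: P.square_integrable_imp_integrable)
    show "integrable M (obsY T Yp G D t)" if "t \<in> {1..T}" for t
      using obs_moments[rule_format, OF that] by (blast intro: P.square_integrable_imp_integrable)
    show "0 < measure M (evt M (\<lambda>\<omega>. G \<omega> = h))" if "h \<in> Gs" for h
      using G_pos that by blast
  qed (use D_G A2a_cond A2c PT in \<open>blast intro: G_meas D_meas A2b\<close>)+
  have bounds: "2 \<le> g" "g \<le> T" "2 \<le> k" "k \<le> T"
    using g_in k_in Gs_sub by (auto simp: subset_iff le_Suc_eq)
  \<comment> \<open>In order: POST(g) - PRE(g), MID(g,k) - PRE(g), POST(k) - MID(g,k), POST(k) -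
    PRE(g).\<close>
  have w: "S.windows g T 1 (g - 1)" "S.windows g (k - 1) 1 (g - 1)"
      "S.windows k T g (k - 1)" "S.windows k T 1 (g - 1)"
    using bounds gk by (auto simp: S.windows_def)
  let ?pi = "\<lambda>a1 a2 b1 b2 h. piD M T Yp G D mDY a1 a2 b1 b2 h"
  let ?p = "\<lambda>h l. cprob M (evt M (\<lambda>\<omega>. D \<omega> \<ge> l)) (?cG h)"

  have within: "deltaWITHIN M T Yp G D g =
      integral {dL..dU} (\<lambda>l. w1within M G D g l * ACRT_plus dL dU ATT g g T l)"
  proof -
    have "((\<lambda>l. w1within M G D g l * ACRT_plus dL dU ATT g g T l) has_integral
        deltaWITHIN M T Yp G D g) {dL..dU}"
    proof (rule has_integral_eq)
      show "((\<lambda>l. (cexp M D (evt M (\<lambda>\<omega>. G \<omega> = g \<and> D \<omega> \<ge> l)) - cexp M D (?cG g)) * ?p g l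
          * dw (?pi g T 1 (g - 1) g) {dL..dU} l / cvar M D (?cG g)) has_integral
          deltaWITHIN M T Yp G D g) {dL..dU}"
        unfolding deltaWITHIN_def Let_def
        by (intro has_integral_divide S.ccov_Ydiff_expansion w g_in bounds)
      show "(cexp M D (evt M (\<lambda>\<omega>. G \<omega> = g \<and> D \<omega> \<ge> l)) - cexp M D (?cG g)) * ?p g l
          * dw (?pi g T 1 (g - 1) g) {dL..dU} l / cvar M D (?cG g) =
          w1within M G D g l * ACRT_plus dL dU ATT g g T l" if "l \<in> {dL..dU}" for l
        using S.ACRT_plus_eq_dw_piD[OF w(1) g_in(1) bounds(2) _ _ ATT_ver(1) ATT_dif(1) that] bounds
        by (simp add: w1within_def Let_def)
    qed
    then show ?thesis by (simp add: integral_unique)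
  qed

  \<comment> \<open>Shared by MID - PRE with h = g and by POST - MID with h = k. The
    \<open>w0\<close> term equals \<open>piD\<close> at \<open>dL\<close> over the mean dose,
    exactly what the layer-cake integral lacks.\<close>
  have expansion: "integral {dL..dU} (\<lambda>l. w1 M G D h l * ACRT_plus dL dU ATT h a1 a2 l)
      + w0 M G D dL h * ATT a1 a2 h dL dL / dL
    = (cexp M (S.Ydiff a1 a2 b1 b2) (?cG h) - S.cexp0 (S.Ydiff a1 a2 b1 b2)) / cexp M D (?cG h)"
    if win: "S.windows a1 a2 b1 b2" and h: "h \<in> Gs" "h \<le> T" and ab: "h \<le> a1" "b2 < h"
      and ver: "ATT_version M T Yp G D dL dU ATT h a1 a2" and dif: "ATT_diff dL dU ATT h a1 a2"
    for a1 a2 b1 b2 h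
  proof -
    have "((\<lambda>l. w1 M G D h l * ACRT_plus dL dU ATT h a1 a2 l) has_integral
        (cexp M (S.Ydiff a1 a2 b1 b2) (?cG h) - S.cexp0 (S.Ydiff a1 a2 b1 b2)
           - ?pi a1 a2 b1 b2 h dL) / cexp M D (?cG h)) {dL..dU}"
      by (rule has_integral_eq[OF _ has_integral_divide[OF S.cexp_Ydiff_expansion[OF win h]]])
        (simp add: w1_def S.ACRT_plus_eq_dw_piD[OF win h ab ver dif])
    then show ?thesis
      using A2b S.ATT_diagonal_eq_piD[OF win h ab ver dif, of dL]
      by (simp add: integral_unique w0_def add_divide_distrib[symmetric])
  qed

  have mid_pre: "deltaMIDPRE M T Yp G D g k =
      integral {dL..dU} (\<lambda>l. w1 M G D g l * ACRT_plus dL dU ATT g g (k - 1) l)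
      + w0 M G D dL g * ATT g (k - 1) g dL dL / dL"
    using expansion[OF w(2) g_in(1) bounds(2) _ _ ATT_ver(2) ATT_dif(2)]
      S.cexp_Ydiff_untreated[OF w(2) k_in(1)] bounds gk
    by (simp add: deltaMIDPRE_def Let_def)

  have post_mid: "deltaPOSTMID M T Yp G D g k =
      integral {dL..dU} (\<lambda>l. w1 M G D k l * ACRT_plus dL dU ATT k k T l)
      + w0 M G D dL k * ATT k T k dL dL / dL
      - w0 M G D dL k * (piAB M T Yp G D k T 1 (g - 1) g - piAB M T Yp G D g (k - 1) 1 (g - 1) g) / dL"
  proof -
    \<comment> \<open>POST(k) - MID(g,k) is POST(k) - PRE(g) minus MID(g,k) - PRE(g), so the two
      \<open>piAB\<close> terms combine into the change of the already treated group g relative to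
      the never treated.\<close>
    have pi: "piAB M T Yp G D k T 1 (g - 1) g - piAB M T Yp G D g (k - 1) 1 (g - 1) g =
        cexp M (S.Ydiff k T g (k - 1)) (?cG g) - S.cexp0 (S.Ydiff k T g (k - 1))"
    proof -
      have "cexp M (S.Ydiff k T g (k - 1)) A =
          cexp M (S.Ydiff k T 1 (g - 1)) A - cexp M (S.Ydiff g (k - 1) 1 (g - 1)) A"
        if "A \<in> sets M" for A
        using cexp_diff[OF that S.Ydiff_integrable(1)[OF w(4)] S.Ydiff_integrable(1)[OF w(2)]] by simp
      then show ?thesis
        using S.sets_evt_G S.sets_evt_D0 by (simp add: piAB_def Let_def)
    qed
    have "k \<le> k" "k - 1 < k" using bounds by auto
    note expansion[OF w(3) k_in(1) bounds(4) this ATT_ver(4) ATT_dif(4)]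
    then show ?thesis
      unfolding pi using A2b
      by (simp add: deltaPOSTMID_def Let_def w0_def diff_divide_distrib)
  qed

  have post_pre: "deltaPOSTPRE M T Yp G D g k =
      integral {dL..dU} (\<lambda>l. w1across M G D g k l * ACRT_plus dL dU ATT g k T l)
      - (integral {dL..dU} (\<lambda>l. w1across_t M G D g k l *
            (dw (?pi k T 1 (g - 1) k) {dL..dU} l - dw (?pi k T 1 (g - 1) g) {dL..dU} l))
         + w0across_t M G D dL g k * (?pi k T 1 (g - 1) k dL - ?pi k T 1 (g - 1) g dL) / dL)"
  proof -
    let ?q = "\<lambda>h. dw (?pi k T 1 (g - 1) h) {dL..dU}"
    define \<Delta> where "\<Delta> = cexp M D (?cG g) - cexp M D (?cG k)"
    have ig: "((\<lambda>l. ?p g l * ?q g l) has_integral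
        cexp M (S.Ydiff k T 1 (g - 1)) (?cG g) - S.cexp0 (S.Ydiff k T 1 (g - 1)) - ?pi k T 1 (g - 1) g dL)
        {dL..dU}" (is "(_ has_integral ?Ig) _")
      by (rule S.cexp_Ydiff_expansion[OF w(4) g_in(1) bounds(2)])
    have ik: "((\<lambda>l. ?p k l * ?q k l) has_integral
        cexp M (S.Ydiff k T 1 (g - 1)) (?cG k) - S.cexp0 (S.Ydiff k T 1 (g - 1)) - ?pi k T 1 (g - 1) k dL)
        {dL..dU}" (is "(_ has_integral ?Ik) _")
      by (rule S.cexp_Ydiff_expansion[OF w(4) k_in(1) bounds(4)])
    \<comment> \<open>J pairs the dose tails of group k with the slope of group g. Subtracted from
      the integral of group g it gives the \<open>w1across\<close> term, and from that of group k
      the \<open>w1across_t\<close> term; in the difference of these two J cancels, together with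
      the never-treated mean.\<close>
    obtain J where J: "((\<lambda>l. ?p k l * ?q g l) has_integral J) {dL..dU}"
      using S.cexp_C1_expansion[OF k_in(1) bounds(4)
          S.window_diff_has_derivative_dw_piD[OF w(4) g_in(1) bounds(2)]] by blast
    have "((\<lambda>l. w1across M G D g k l * ACRT_plus dL dU ATT g k T l) has_integral (?Ig - J) / \<Delta>) {dL..dU}"
      by (rule has_integral_eq[OF _ has_integral_divide[OF has_integral_diff[OF ig J]]])
        (use S.ACRT_plus_eq_dw_piD[OF w(4) g_in(1) bounds(2) _ _ ATT_ver(3) ATT_dif(3)] bounds gk in
          \<open>simp add: w1across_def \<Delta>_def left_diff_distrib\<close>)
    moreover have "((\<lambda>l. w1across_t M G D g k l * (?q k l - ?q g l)) has_integral (?Ik - J) / \<Delta>) {dL..dU}"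
      by (rule has_integral_eq[OF _ has_integral_divide[OF has_integral_diff[OF ik J]]])
        (simp add: w1across_t_def \<Delta>_def right_diff_distrib diff_divide_distrib)
    moreover have "w0across_t M G D dL g k * x / dL = x / \<Delta>" for x
      using A2b by (simp add: w0across_t_def \<Delta>_def)
    moreover have "deltaPOSTPRE M T Yp G D g k =
        (cexp M (S.Ydiff k T 1 (g - 1)) (?cG g) - cexp M (S.Ydiff k T 1 (g - 1)) (?cG k)) / \<Delta>"
      by (simp add: deltaPOSTPRE_def Let_def \<Delta>_def)
    ultimately show ?thesis
      by (simp add: integral_unique diff_divide_distrib)
  qed

  show ?thesis
    using within mid_pre post_mid post_pre by blast
qed

end
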